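(* Let $n,k$ be positive integers, let $r$ be a non-negative integer with $r<n$, let $\rho=(\rho_1,\dots,\rho_k)$ be integers with $1\le \rho_\ell\le n\le k$ for all $\ell\in[k]$ and $\sum_{\ell\in[k]}\rho_\ell=n^2$, and let $d=(d_1,\dots,d_k)$ be non-negative integers with $D:=\sum_{\ell\in[k]}d_\ell\le n-r$. Let $L$ be an $r\times r$ symmetric $\rho$-latin rectangle, let $e_\ell$ be the number of occurrences of $\ell$ in $L$ for $\ell\in[k]$, and let $q$ be the number of symbols $\ell\in[k]$ such that $\rho_\ell+e_\ell+d_\ell$ is odd. Suppose that $e_\ell\ge 2r+d_\ell-\rho_\ell$ for all $\ell\in[k]$. Consider the conditions $$\text{(A)}\quad \sum_{\ell\in K}\max\{0,\ \rho_\ell-e_\ell+r-n\}\le\sum_{i\in[r]}\min\{n-r,\ \mu_K(i)\}\qquad\text{for all } K\subseteq[k];$$ $$\text{(B)}\quad (n-r)(r-|I|)\ge\sum_{\ell\in[k]}\max\{0,\ \rho_\ell-e_\ell-n+r-\mu_I(\ell)\}\qquad\text{for all } I\subseteq[r].$$ Then the following three statements are equivalent: (1) $L$ can be embedded in an $n\times n$ symmetric $\rho$-latin square with prescribed diagonal tail $d$; (2) $(n-r-D-q)/2$ is a non-negative integer and (A) holds; (3) $(n-r-D-q)/2$ is a non-negative integer and (B) holds.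
   Context: $[m]=\{1,\dots,m\}$. An $r\times r$ $\rho$-latin rectangle is an $r\times r$ array, every cell of which is filled with a symbol from $[k]$, such that each symbol occurs at most once in each row and at most once in each column, and each symbol $\ell\in[k]$ occurs at most $\rho_\ell$ times in the array. An $n\times n$ $\rho$-latin square is an $n\times n$ array, every cell filled with a symbol from $[k]$, such that each symbol occurs at most once in each row and at most once in each column, and each symbol $\ell\in[k]$ occurs exactly $\rho_\ell$ times. An array $A$ is symmetric if $A_{ij}=A_{ji}$ for all $i,j$. $L$ can be embedded in (completed to, extended to) an $n\times n$ array $L'$ means that $L$ is the top left $r\times r$ subarray of $L'$. $L'$ has prescribed diagonal tail $d$ means that each symbol $\ell\in[k]$ occurs at least $d_\ell$ times among the entries $L'_{ii}$, $r+1\le i\le n$. For $I\subseteq[r]$ and $\ell\in[k]$, $\mu_I(\ell)$ is the number of rows $i\in I$ of $L$ in which symbol $\ell$ does not occur. For $K\subseteq[k]$ and $i\in[r]$, $\mu_K(i)$ is the number of symbols in $K$ that do not occur in row $i$ of $L$. *)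

theory Defs
  imports Complex_Main
begin

text \<open>An \<open>m \<times> m\<close> array is a function \<open>A :: nat \<Rightarrow> nat \<Rightarrow> nat\<close> of which only the
  values \<open>A i j\<close> with \<open>1 \<le> i, j \<le> m\<close> are meaningful; the size \<open>m\<close> is always passed explicitly.
  The symbol set \<open>[k]\<close> is \<open>{1..k}\<close>.\<close>

type_synonym array = "nat \<Rightarrow> nat \<Rightarrow> nat"

definition occurrences :: "nat \<Rightarrow> array \<Rightarrow> nat \<Rightarrow> nat" where
  "occurrences m A l = card {(i, j). i \<in> {1..m} \<and> j \<in> {1..m} \<and> A i j = l}"

definition filled_latin :: "nat \<Rightarrow> nat \<Rightarrow> array \<Rightarrow> bool" where
  "filled_latin m k A \<longleftrightarrow>
     (\<forall>i\<in>{1..m}. \<forall>j\<in>{1..m}. A i j \<in> {1..k}) \<and>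
     (\<forall>l\<in>{1..k}. \<forall>i\<in>{1..m}. card {j \<in> {1..m}. A i j = l} \<le> 1) \<and>
     (\<forall>l\<in>{1..k}. \<forall>j\<in>{1..m}. card {i \<in> {1..m}. A i j = l} \<le> 1)"

definition rho_latin_rectangle :: "nat \<Rightarrow> nat \<Rightarrow> (nat \<Rightarrow> nat) \<Rightarrow> array \<Rightarrow> bool" where
  "rho_latin_rectangle r k \<rho> L \<longleftrightarrow>
     filled_latin r k L \<and> (\<forall>l\<in>{1..k}. occurrences r L l \<le> \<rho> l)"

definition rho_latin_square :: "nat \<Rightarrow> nat \<Rightarrow> (nat \<Rightarrow> nat) \<Rightarrow> array \<Rightarrow> bool" where
  "rho_latin_square n k \<rho> L \<longleftrightarrow>
     filled_latin n k L \<and> (\<forall>l\<in>{1..k}. occurrences n L l = \<rho> l)"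

definition symmetric_array :: "nat \<Rightarrow> array \<Rightarrow> bool" where
  "symmetric_array m A \<longleftrightarrow> (\<forall>i\<in>{1..m}. \<forall>j\<in>{1..m}. A i j = A j i)"

definition top_left_subarray :: "nat \<Rightarrow> array \<Rightarrow> array \<Rightarrow> bool" where
  "top_left_subarray r L L' \<longleftrightarrow> (\<forall>i\<in>{1..r}. \<forall>j\<in>{1..r}. L' i j = L i j)"

definition has_diagonal_tail :: "nat \<Rightarrow> nat \<Rightarrow> nat \<Rightarrow> (nat \<Rightarrow> nat) \<Rightarrow> array \<Rightarrow> bool" where
  "has_diagonal_tail r n k d L' \<longleftrightarrow>
     (\<forall>l\<in>{1..k}. d l \<le> card {i \<in> {r+1..n}. L' i i = l})"

definition symmetrically_embeddable ::
    "nat \<Rightarrow> nat \<Rightarrow> nat \<Rightarrow> (nat \<Rightarrow> nat) \<Rightarrow> (nat \<Rightarrow> nat) \<Rightarrow> array \<Rightarrow> bool" where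
  "symmetrically_embeddable r n k \<rho> d L \<longleftrightarrow>
     (\<exists>L'. rho_latin_square n k \<rho> L' \<and> symmetric_array n L' \<and>
           top_left_subarray r L L' \<and> has_diagonal_tail r n k d L')"

text \<open>\<open>mu_rows r L I l\<close> is \<open>\<mu>\<^sub>I(l)\<close> and \<open>mu_symbols r L K i\<close> is \<open>\<mu>\<^sub>K(i)\<close>, for the \<open>r \<times> r\<close> array \<open>L\<close>.\<close>

definition mu_rows :: "nat \<Rightarrow> array \<Rightarrow> nat set \<Rightarrow> nat \<Rightarrow> nat" where
  "mu_rows r L I l = card {i \<in> I. \<forall>j\<in>{1..r}. L i j \<noteq> l}"

definition mu_symbols :: "nat \<Rightarrow> array \<Rightarrow> nat set \<Rightarrow> nat \<Rightarrow> nat" where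
  "mu_symbols r L K i = card {l \<in> K. \<forall>j\<in>{1..r}. L i j \<noteq> l}"

end

theory Submission
  imports Defs
begin

text \<open>Necessity of the conditions is counting: in a completion, symbol \<open>l\<close> occurs at most \<open>n - r\<close>
  times in the last \<open>n - r\<close> rows, hence at least \<open>\<rho> l - e l + r - n\<close> times to the right of \<open>L\<close>, and
  by symmetry the parity of \<open>\<rho> l + e l\<close> is that of its number of occurrences on the diagonal tail.

  Conversely, Hall's theorem turns (A) into a choice, for each row of \<open>L\<close>, of the \<open>n - r\<close> symbols
  to its right; the remaining occurrences of each symbol are then split into diagonal and
  off-diagonal cells of the bottom right corner. These multiplicities alone suffice: new rows and
  columns are added one at a time, each time by a perfect matching in the support of a doubly
  stochastic matrix.\<close>

text \<open>Let \<open>f l\<close> be the number of rows of \<open>L\<close> that receive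
  \<open>l\<close> on their right. Those rows miss \<open>l\<close>, so
  \<open>f l \<le> r - e l\<close> and \<open>\<rho> l - e l - 2 * f l \<ge> \<rho> l + e l - 2 * r
  \<ge> d l\<close>. Thus the lower bound on \<open>e l\<close> leaves room in the corner for the
  prescribed diagonal entries, whatever symbols Hall's theorem selects. On the tail,
  \<open>l\<close> occurs with the parity of \<open>\<rho> l + e l\<close>: beyond
  \<open>d l\<close> it needs one further diagonal cell if \<open>\<rho> l + e l + d l\<close> is
  odd, and all other diagonal cells are filled by equal pairs. Hence the
  \<open>n - r - D - q\<close> remaining cells must be even in number. A symbol occurs at most once
  in each of the last \<open>n - r\<close> columns. Since it has \<open>\<rho> l - e l - f l\<close>
  cells there, this means \<open>f l \<ge> \<rho> l - e l + r - n\<close>, the demand in (A) and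
  (B). The same bound is the invariant when rows are added: a symbol that attains it has to occur in
  the next row.\<close>

section \<open>Hall's theorem and two consequences\<close>

text \<open>A tight proper subset is matched inside its own neighbours, which are then deleted for
  the rest. Without tight sets every nonempty proper subset has a spare neighbour, so an arbitrary
  pair can be fixed and removed.\<close>

lemma hall:
  fixes N :: "'a \<Rightarrow> 'b set"
  assumes "finite I" and "\<And>i. i \<in> I \<Longrightarrow> finite (N i)"
    and "\<And>J. J \<subseteq> I \<Longrightarrow> card J \<le> card (\<Union>(N ` J))"
  shows "\<exists>\<sigma>. inj_on \<sigma> I \<and> (\<forall>i\<in>I. \<sigma> i \<in> N i)"
  using assms
proof (induction "card I" arbitrary: I N rule: less_induct)
  case (less I N)
  note fin = less.prems(1) and finN = less.prems(2) and cond = less.prems(3)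
  show ?case
  proof (cases "\<exists>J. J \<subset> I \<and> J \<noteq> {} \<and> card J = card (\<Union>(N ` J))")
    case True
    then obtain J where J: "J \<subset> I" "J \<noteq> {}" "card J = card (\<Union>(N ` J))" by blast
    define V where "V = \<Union>(N ` J)"
    have finJ: "finite J" using J fin finite_subset by blast
    have finV: "finite V" using finJ finN J unfolding V_def by blast
    have "\<exists>\<sigma>. inj_on \<sigma> J \<and> (\<forall>i\<in>J. \<sigma> i \<in> N i)"
    proof (rule less.hyps)
      show "card J < card I" using J(1) fin by (rule psubset_card_mono[rotated])
      show "finite J" by (rule finJ)
      show "finite (N i)" if "i \<in> J" for i using finN J that by blast
      show "card J' \<le> card (\<Union>(N ` J'))" if "J' \<subseteq> J" for J'
        using cond[of J'] J that by blast
    qed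
    then obtain \<sigma> where \<sigma>: "inj_on \<sigma> J" "\<And>i. i \<in> J \<Longrightarrow> \<sigma> i \<in> N i" by blast
    have "\<exists>\<tau>. inj_on \<tau> (I - J) \<and> (\<forall>i\<in>I - J. \<tau> i \<in> N i - V)"
    proof (rule less.hyps)
      show "card (I - J) < card I" using J fin by (intro psubset_card_mono) auto
      show "finite (I - J)" using fin by simp
      show "finite (N i - V)" if "i \<in> I - J" for i using finN that by blast
      show "card J' \<le> card (\<Union>i\<in>J'. N i - V)" if J': "J' \<subseteq> I - J" for J'
      proof -
        have finJ': "finite J'" using J' fin finite_subset by blast
        have finU: "finite (\<Union>i\<in>J'. N i - V)" using finJ' finN J' by blast
        \<comment> \<open>The condition for \<open>J \<union> J'\<close> becomes the one for
          \<open>J'\<close> after cancelling \<open>card J = card V\<close>.\<close>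
        have "card J + card J' = card (J \<union> J')"
          using finJ finJ' J' by (subst card_Un_disjoint) auto
        also have "\<dots> \<le> card (\<Union>(N ` (J \<union> J')))" using cond[of "J \<union> J'"] J J' by blast
        also have "\<Union>(N ` (J \<union> J')) = V \<union> (\<Union>i\<in>J'. N i - V)" unfolding V_def by blast
        also have "card \<dots> = card V + card (\<Union>i\<in>J'. N i - V)"
          using finV finU by (subst card_Un_disjoint) auto
        finally show ?thesis using J(3) V_def by simp
      qed
    qed
    then obtain \<tau> where \<tau>: "inj_on \<tau> (I - J)" "\<And>i. i \<in> I - J \<Longrightarrow> \<tau> i \<in> N i - V" by blast
    define \<phi> where "\<phi> i = (if i \<in> J then \<sigma> i else \<tau> i)" for i
    have "\<sigma> i \<in> V" if "i \<in> J" for i using \<sigma>(2) that unfolding V_def by blast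
    then have "inj_on \<phi> I"
      using \<sigma>(1) \<tau> by (smt (verit) DiffD2 DiffI \<phi>_def inj_on_def)
    moreover have "\<forall>i\<in>I. \<phi> i \<in> N i" using \<sigma>(2) \<tau>(2) by (simp add: \<phi>_def)
    ultimately show ?thesis by blast
  next
    case False
    show ?thesis
    proof (cases "I = {}")
      case True
      then show ?thesis by simp
    next
      case False
      then obtain i0 where i0: "i0 \<in> I" by blast
      have "N i0 \<noteq> {}" using cond[of "{i0}"] i0 by auto
      then obtain y where y: "y \<in> N i0" by blast
      have "\<exists>\<sigma>. inj_on \<sigma> (I - {i0}) \<and> (\<forall>i\<in>I - {i0}. \<sigma> i \<in> N i - {y})"
      proof (rule less.hyps)
        show "card (I - {i0}) < card I" using i0 fin by (rule card_Diff1_less[rotated])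
        show "finite (I - {i0})" using fin by simp
        show "finite (N i - {y})" if "i \<in> I - {i0}" for i using finN that by blast
        show "card J \<le> card (\<Union>i\<in>J. N i - {y})" if J: "J \<subseteq> I - {i0}" for J
        proof (cases "J = {}")
          case False
          have "card J \<le> card (\<Union>(N ` J))" using cond[of J] J by blast
          moreover have "card J \<noteq> card (\<Union>(N ` J))"
            using \<open>\<not> (\<exists>J. J \<subset> I \<and> J \<noteq> {} \<and> card J = card (\<Union>(N ` J)))\<close> J False i0 by blast
          moreover have "(\<Union>i\<in>J. N i - {y}) = \<Union>(N ` J) - {y}" by blast
          ultimately show ?thesis
            using diff_card_le_card_Diff[of "{y}" "\<Union>(N ` J)"] by simp
        qed simp
      qed
      then obtain \<sigma> where \<sigma>: "inj_on \<sigma> (I - {i0})" "\<And>i. i \<in> I - {i0} \<Longrightarrow> \<sigma> i \<in> N i - {y}"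
        by blast
      have "inj_on (\<sigma>(i0 := y)) I"
        using \<sigma> by (auto simp: inj_on_def)
      moreover have "\<forall>i\<in>I. (\<sigma>(i0 := y)) i \<in> N i" using \<sigma>(2) y by auto
      ultimately show ?thesis by blast
    qed
  qed
qed

text \<open>The weight \<open>m * card J\<close> leaving \<open>J\<close> lands on its neighbours in
  the support, each of which holds only \<open>m\<close>; this is Hall's condition. Equal margins
  also force \<open>card X = card Y\<close>, so the matching is perfect.\<close>

lemma doubly_stochastic_bij:
  fixes w :: "'a \<Rightarrow> 'b \<Rightarrow> real"
  assumes fin: "finite X" "finite Y" and m: "m > 0"
    and nonneg: "\<And>x y. x \<in> X \<Longrightarrow> y \<in> Y \<Longrightarrow> w x y \<ge> 0"
    and rows: "\<And>x. x \<in> X \<Longrightarrow> (\<Sum>y\<in>Y. w x y) = m"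
    and cols: "\<And>y. y \<in> Y \<Longrightarrow> (\<Sum>x\<in>X. w x y) = m"
  shows "\<exists>\<sigma>. bij_betw \<sigma> X Y \<and> (\<forall>x\<in>X. w x (\<sigma> x) > 0)"
proof -
  define N where "N x = {y \<in> Y. w x y > 0}" for x
  have "m * card X = (\<Sum>x\<in>X. \<Sum>y\<in>Y. w x y)" using rows by simp
  also have "\<dots> = (\<Sum>y\<in>Y. \<Sum>x\<in>X. w x y)" by (rule sum.swap)
  also have "\<dots> = m * card Y" using cols by simp
  finally have card_eq: "card X = card Y" using m by simp
  have "\<exists>\<sigma>. inj_on \<sigma> X \<and> (\<forall>x\<in>X. \<sigma> x \<in> N x)"
  proof (rule hall)
    show "finite (N x)" for x using fin by (simp add: N_def)
    show "card J \<le> card (\<Union>(N ` J))" if J: "J \<subseteq> X" for J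
    proof -
      have sub: "\<Union>(N ` J) \<subseteq> Y" by (auto simp: N_def)
      have "m * card J = (\<Sum>x\<in>J. \<Sum>y\<in>Y. w x y)" using rows J by (simp add: subset_iff)
      also have "\<dots> = (\<Sum>x\<in>J. \<Sum>y\<in>\<Union>(N ` J). w x y)"
      proof (rule sum.cong[OF refl])
        fix x assume x: "x \<in> J"
        have "w x y = 0" if "y \<in> Y - \<Union>(N ` J)" for y
          using nonneg[of x y] J x that by (force simp: N_def)
        then show "(\<Sum>y\<in>Y. w x y) = (\<Sum>y\<in>\<Union>(N ` J). w x y)"
          by (intro sum.mono_neutral_right) (use fin sub in auto)
      qed
      also have "\<dots> = (\<Sum>y\<in>\<Union>(N ` J). \<Sum>x\<in>J. w x y)" by (rule sum.swap)
      also have "\<dots> \<le> (\<Sum>y\<in>\<Union>(N ` J). \<Sum>x\<in>X. w x y)"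
        using sub by (intro sum_mono sum_mono2) (use fin J nonneg in auto)
      also have "\<dots> = m * card (\<Union>(N ` J))" using cols sub by (simp add: subset_iff)
      finally show ?thesis using m by simp
    qed
  qed (rule fin)
  then obtain \<sigma> where \<sigma>: "inj_on \<sigma> X" "\<And>x. x \<in> X \<Longrightarrow> \<sigma> x \<in> N x" by blast
  have "\<sigma> ` X = Y"
    using \<sigma> fin card_eq by (intro card_subset_eq) (auto simp: N_def card_image)
  then show ?thesis using \<sigma> by (auto simp: bij_betw_def N_def)
qed

text \<open>\<open>cond\<close> is a cut condition: rows outside \<open>I'\<close> supply at most
  \<open>c\<close> each, and rows in \<open>I'\<close> at most their edges to \<open>K'\<close>.
  Matching edges rather than vertices lets Hall's theorem bound the selected edges of a row and the
  rejected edges of a symbol at once.\<close>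

lemma bipartite_subgraph_degrees:
  fixes E :: "'a \<Rightarrow> 'b \<Rightarrow> bool" and a :: "'b \<Rightarrow> nat"
  assumes fin: "finite I" "finite K"
    and deg: "\<And>l. l \<in> K \<Longrightarrow> a l \<le> card {i \<in> I. E i l}"
    and cond: "\<And>I' K'. I' \<subseteq> I \<Longrightarrow> K' \<subseteq> K \<Longrightarrow>
      (\<Sum>l\<in>K'. a l) \<le> c * card (I - I') + (\<Sum>l\<in>K'. card {i \<in> I'. E i l})"
  shows "\<exists>F. (\<forall>i\<in>I. F i \<subseteq> {l \<in> K. E i l} \<and> card (F i) \<le> c) \<and>
             (\<forall>l\<in>K. a l \<le> card {i \<in> I. l \<in> F i})"
proof -
  define G where "G = {(i, l). i \<in> I \<and> l \<in> K \<and> E i l}"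
  define dg where "dg l = card {i \<in> I. E i l}" for l
  text \<open>An edge is matched to a slot of its row if it is selected, and otherwise to one of the
    slots of its symbol, of which there are only as many as edges that may be left out.\<close>
  define N where "N p = Inl ` ({fst p} \<times> {..<c}) \<union> Inr ` ({snd p} \<times> {..<dg (snd p) - a (snd p)})"
    for p :: "'a \<times> 'b"
  have finG: "finite G"
    by (rule finite_subset[of _ "I \<times> K"]) (use fin in \<open>auto simp: G_def\<close>)
  have "\<exists>\<sigma>. inj_on \<sigma> G \<and> (\<forall>p\<in>G. \<sigma> p \<in> N p)"
  proof (rule hall[OF finG])
    show "finite (N p)" for p by (simp add: N_def)
    show "card S \<le> card (\<Union>(N ` S))" if S: "S \<subseteq> G" for S
    proof -
      define J where "J = fst ` S"
      define M where "M = snd ` S"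
      have JM: "J \<subseteq> I" "M \<subseteq> K" using S by (auto simp: J_def M_def G_def)
      then have finJM: "finite J" "finite M" using fin finite_subset by blast+
      have N: "\<Union>(N ` S) = Inl ` (J \<times> {..<c}) \<union> Inr ` (SIGMA l:M. {..<dg l - a l})"
        by (force simp: N_def J_def M_def)
      have "card (\<Union>(N ` S)) = card (J \<times> {..<c}) + card (SIGMA l:M. {..<dg l - a l})"
        unfolding N using finJM by (subst card_Un_disjoint) (auto simp: card_image)
      also have "\<dots> = c * card J + (\<Sum>l\<in>M. dg l - a l)"
        using finJM by (simp add: card_cartesian_product)
      finally have cN: "card (\<Union>(N ` S)) = c * card J + (\<Sum>l\<in>M. dg l - a l)" .
      have "S \<subseteq> (\<lambda>(l, i). (i, l)) ` (SIGMA l:M. {i \<in> J. E i l})"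
        using S by (force simp: J_def M_def G_def image_iff)
      then have "card S \<le> card (SIGMA l:M. {i \<in> J. E i l})"
        by (rule surj_card_le[rotated]) (use finJM in auto)
      also have "\<dots> = (\<Sum>l\<in>M. card {i \<in> J. E i l})" using finJM by simp
      finally have cS: "card S \<le> (\<Sum>l\<in>M. card {i \<in> J. E i l})" .
      have split: "dg l = card {i \<in> J. E i l} + card {i \<in> I - J. E i l}" for l
      proof -
        have "{i \<in> I. E i l} = {i \<in> J. E i l} \<union> {i \<in> I - J. E i l}" using JM by blast
        then show ?thesis unfolding dg_def
          using fin finJM by (simp add: card_Un_disjoint[symmetric] disjoint_iff)
      qed
      \<comment> \<open>\<open>S\<close> is no larger than the set of all edges between
        \<open>J\<close> and \<open>M\<close>, and for that set Hall's condition is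
        \<open>cond\<close> at the rows outside \<open>J\<close>.\<close>
      have "(\<Sum>l\<in>M. a l) \<le> c * card J + (\<Sum>l\<in>M. card {i \<in> I - J. E i l})"
        using cond[of "I - J" M] JM by (simp add: double_diff)
      moreover have "(\<Sum>l\<in>M. dg l - a l) + (\<Sum>l\<in>M. a l) = (\<Sum>l\<in>M. dg l)"
        unfolding sum.distrib[symmetric] using deg JM by (intro sum.cong) (auto simp: dg_def)
      moreover have "(\<Sum>l\<in>M. dg l) = (\<Sum>l\<in>M. card {i \<in> J. E i l}) + (\<Sum>l\<in>M. card {i \<in> I - J. E i l})"
        by (simp add: split sum.distrib)
      ultimately show ?thesis using cN cS by linarith
    qed
  qed
  then obtain \<sigma> where \<sigma>: "inj_on \<sigma> G" "\<And>p. p \<in> G \<Longrightarrow> \<sigma> p \<in> N p" by blast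
  define F where "F i = {l \<in> K. E i l \<and> \<sigma> (i, l) \<in> range Inl}" for i
  have "card (F i) \<le> c" if i: "i \<in> I" for i
  proof -
    have "card (F i) \<le> card (Inl ` ({i} \<times> {..<c}) :: ('a \<times> nat + 'b \<times> nat) set)"
    proof (rule card_inj_on_le)
      show "inj_on (\<lambda>l. \<sigma> (i, l)) (F i)"
        using \<sigma>(1) i by (auto simp: inj_on_def F_def G_def)
      show "(\<lambda>l. \<sigma> (i, l)) ` F i \<subseteq> Inl ` ({i} \<times> {..<c})"
        using \<sigma>(2) i by (fastforce simp: F_def G_def N_def)
    qed simp
    then show ?thesis by (simp add: card_image card_cartesian_product)
  qed
  moreover have "a l \<le> card {i \<in> I. l \<in> F i}" if l: "l \<in> K" for l
  proof -
    \<comment> \<open>Rejected edges of \<open>l\<close> occupy distinct slots of \<open>l\<close>,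
      so enough edges remain selected.\<close>
    have "card {i \<in> I. E i l \<and> l \<notin> F i}
        \<le> card (Inr ` ({l} \<times> {..<dg l - a l}) :: ('a \<times> nat + 'b \<times> nat) set)"
    proof (rule card_inj_on_le)
      show "inj_on (\<lambda>i. \<sigma> (i, l)) {i \<in> I. E i l \<and> l \<notin> F i}"
        using \<sigma>(1) l by (auto simp: inj_on_def G_def)
      show "(\<lambda>i. \<sigma> (i, l)) ` {i \<in> I. E i l \<and> l \<notin> F i} \<subseteq> Inr ` ({l} \<times> {..<dg l - a l})"
        using \<sigma>(2) l by (fastforce simp: F_def G_def N_def)
    qed simp
    then have le: "card {i \<in> I. E i l \<and> l \<notin> F i} \<le> dg l - a l"
      by (simp add: card_image card_cartesian_product)
    have "{i \<in> I. E i l} = {i \<in> I. l \<in> F i} \<union> {i \<in> I. E i l \<and> l \<notin> F i}"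
      by (auto simp: F_def)
    then have "dg l \<le> card {i \<in> I. l \<in> F i} + card {i \<in> I. E i l \<and> l \<notin> F i}"
      unfolding dg_def by (metis (no_types, lifting) card_Un_le)
    then show ?thesis using le deg[OF l] by (simp add: dg_def)
  qed
  ultimately show ?thesis by (intro exI[of _ F]) (auto simp: F_def)
qed

section \<open>Sums, occurrences and symmetric arrays\<close>

lemma exists_bounded_summands:
  fixes u :: "'a \<Rightarrow> nat"
  assumes "finite X" and "T \<le> (\<Sum>x\<in>X. u x)"
  shows "\<exists>t. (\<forall>x\<in>X. t x \<le> u x) \<and> (\<Sum>x\<in>X. t x) = T"
  using assms
proof (induction X arbitrary: T rule: finite_induct)
  case (insert x X)
  then have "T - min T (u x) \<le> (\<Sum>y\<in>X. u y)" by auto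
  from insert.IH[OF this] obtain t
    where t: "\<forall>y\<in>X. t y \<le> u y" "(\<Sum>y\<in>X. t y) = T - min T (u x)" by blast
  have "(\<Sum>y\<in>X. (t(x := min T (u x))) y) = (\<Sum>y\<in>X. t y)"
    using insert.hyps by (intro sum.cong) auto
  then show ?case
    using t insert.hyps by (intro exI[of _ "t(x := min T (u x))"]) auto
qed simp

lemma occurrences_eq_sum:
  "occurrences m A l = (\<Sum>i\<in>{1..m}. \<Sum>j\<in>{1..m}. of_bool (A i j = l))"
proof -
  have "{(i, j). i \<in> {1..m} \<and> j \<in> {1..m} \<and> A i j = l} = ({1..m} \<times> {1..m}) \<inter> {p. A (fst p) (snd p) = l}"
    by auto
  then have "occurrences m A l = (\<Sum>p\<in>{1..m} \<times> {1..m}. of_bool (A (fst p) (snd p) = l))"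
    by (simp add: occurrences_def sum_of_bool_eq)
  then show ?thesis by (simp add: sum.cartesian_product split_def del: sum_of_bool_eq)
qed

lemma occurrences_Suc:
  "occurrences (Suc m) A l = occurrences m A l + (\<Sum>i\<in>{1..m}. of_bool (A i (Suc m) = l))
     + (\<Sum>j\<in>{1..m}. of_bool (A (Suc m) j = l)) + of_bool (A (Suc m) (Suc m) = l)"
  by (simp add: occurrences_eq_sum sum.distrib)

lemma card_eq_sum_of_bool: "finite X \<Longrightarrow> card {x \<in> X. P x} = (\<Sum>x\<in>X. of_bool (P x))"
  by (simp add: Collect_conj_eq)

lemma sum_of_bool_eq_image:
  assumes "inj_on \<sigma> X" and "finite X"
  shows "(\<Sum>x\<in>X. of_bool (\<sigma> x = y)) = (of_bool (y \<in> \<sigma> ` X) :: nat)"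
proof (cases "y \<in> \<sigma> ` X")
  case True
  then obtain x where x: "x \<in> X" "\<sigma> x = y" by blast
  have "(\<Sum>z\<in>X. of_bool (\<sigma> z = y)) = (\<Sum>z\<in>X. of_bool (z = x) :: nat)"
    using assms x by (intro sum.cong) (auto simp: inj_on_def)
  then show ?thesis using True x assms by (simp add: sum_of_bool_eq)
qed (auto intro!: sum.neutral)

text \<open>In a symmetric array the column condition is the row condition transposed. Injectivity
  of rows is the form that is easily extended by one entry.\<close>

lemma filled_latin_iff_inj_on:
  assumes sym: "symmetric_array m A"
  shows "filled_latin m k A \<longleftrightarrow> (\<forall>i\<in>{1..m}. A i ` {1..m} \<subseteq> {1..k} \<and> inj_on (A i) {1..m})"
proof -
  have col: "{i \<in> {1..m}. A i j = l} = {i \<in> {1..m}. A j i = l}" if "j \<in> {1..m}" for j l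
    using sym that by (auto simp: symmetric_array_def)
  have cols: "(\<forall>l\<in>{1..k}. \<forall>j\<in>{1..m}. card {i \<in> {1..m}. A i j = l} \<le> 1) \<longleftrightarrow>
      (\<forall>l\<in>{1..k}. \<forall>i\<in>{1..m}. card {j \<in> {1..m}. A i j = l} \<le> 1)"
    by (intro ball_cong refl) (simp only: col)
  have rows: "(\<forall>l\<in>{1..k}. card {j \<in> {1..m}. A i j = l} \<le> 1) \<longleftrightarrow> inj_on (A i) {1..m}"
    if A: "\<forall>j\<in>{1..m}. A i j \<in> {1..k}" for i
  proof
    assume le: "\<forall>l\<in>{1..k}. card {j \<in> {1..m}. A i j = l} \<le> 1"
    show "inj_on (A i) {1..m}"
    proof (rule inj_onI)
      fix x y assume xy: "x \<in> {1..m}" "y \<in> {1..m}" "A i x = A i y"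
      define S where "S = {j \<in> {1..m}. A i j = A i x}"
      have "card S \<le> Suc 0" using bspec[OF le bspec[OF A xy(1)]] by (simp only: S_def One_nat_def)
      moreover have "finite S" by (simp add: S_def)
      ultimately have S: "\<forall>u\<in>S. \<forall>v\<in>S. u = v" by (simp only: card_le_Suc0_iff_eq)
      have "x \<in> S" "y \<in> S" using xy by (simp_all add: S_def)
      then show "x = y" by (rule bspec[OF bspec[OF S]])
    qed
  next
    assume inj: "inj_on (A i) {1..m}"
    show "\<forall>l\<in>{1..k}. card {j \<in> {1..m}. A i j = l} \<le> 1"
    proof
      fix l
      define S where "S = {j \<in> {1..m}. A i j = l}"
      have "\<forall>u\<in>S. \<forall>v\<in>S. u = v" using inj unfolding inj_on_def S_def by blast
      moreover have "finite S" by (simp add: S_def)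
      ultimately have "card S \<le> Suc 0" by (simp only: card_le_Suc0_iff_eq)
      then show "card {j \<in> {1..m}. A i j = l} \<le> 1" by (simp only: S_def One_nat_def)
    qed
  qed
  have swap: "(\<forall>l\<in>{1..k}. \<forall>i\<in>{1..m}. Q l i) \<longleftrightarrow> (\<forall>i\<in>{1..m}. \<forall>l\<in>{1..k}. Q l i)" for Q
    by blast
  have "filled_latin m k A \<longleftrightarrow> (\<forall>i\<in>{1..m}. (\<forall>j\<in>{1..m}. A i j \<in> {1..k}) \<and>
      (\<forall>l\<in>{1..k}. card {j \<in> {1..m}. A i j = l} \<le> 1))"
    unfolding filled_latin_def cols swap by (simp only: ball_conj_distrib conj_absorb)
  also have "\<dots> \<longleftrightarrow> (\<forall>i\<in>{1..m}. A i ` {1..m} \<subseteq> {1..k} \<and> inj_on (A i) {1..m})"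
    unfolding image_subset_iff by (intro ball_cong refl conj_cong rows)
  finally show ?thesis .
qed

section \<open>Outlines and their completion row by row\<close>

text \<open>An \<open>r \<times> r\<close> array with only the contents of the remaining \<open>n - r\<close> rows and columns decided,
  not their positions: \<open>F i\<close> is the set of symbols to be placed in row \<open>i\<close> to the right of \<open>L\<close>,
  and in the bottom right corner \<open>l\<close> is used \<open>h l\<close> times on the diagonal
  and \<open>p l\<close> times above it.\<close>

definition outline ::
  "nat \<Rightarrow> nat \<Rightarrow> (nat \<Rightarrow> nat) \<Rightarrow> nat \<Rightarrow> array \<Rightarrow> (nat \<Rightarrow> nat set) \<Rightarrow> (nat \<Rightarrow> nat) \<Rightarrow> (nat \<Rightarrow> nat) \<Rightarrow> bool"
  where
  "outline n k \<rho> r L F h p \<longleftrightarrow>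
     filled_latin r k L \<and> symmetric_array r L \<and>
     (\<forall>i\<in>{1..r}. F i \<subseteq> {1..k} \<and> card (F i) = n - r \<and> F i \<inter> L i ` {1..r} = {}) \<and>
     (\<Sum>l\<in>{1..k}. h l) = n - r \<and> (\<Sum>l\<in>{1..k}. 2 * p l) = (n - r) * (n - r - 1) \<and>
     (\<forall>l\<in>{1..k}. (\<Sum>i\<in>{1..r}. of_bool (l \<in> F i)) + h l + 2 * p l \<le> n - r \<and>
        occurrences r L l + 2 * (\<Sum>i\<in>{1..r}. of_bool (l \<in> F i)) + h l + 2 * p l = \<rho> l)"

text \<open>Dividing the multiplicities of the outline by \<open>n - r\<close> gives a fractional choice of the next
  row: \<open>\<sigma> 1, \<dots>, \<sigma> r\<close> are its entries in the columns of \<open>L\<close>, \<open>\<sigma> (r + 1)\<close> is its diagonal entry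
  and \<open>\<sigma> (r + 2), \<dots>, \<sigma> n\<close> are the symbols still to be placed to the right of it.
  Dummy positions \<open>n + 1, \<dots>, k\<close> absorb the symbols that the row does not use; a symbol that must
  be used in every remaining row has no weight on them.\<close>

lemma outline_next_row:
  assumes out: "outline n k \<rho> r L F h p" and rn: "r < n" and nk: "n \<le> k"
  shows "\<exists>\<sigma>. bij_betw \<sigma> {1..k} {1..k} \<and> (\<forall>i\<in>{1..r}. \<sigma> i \<in> F i) \<and> h (\<sigma> (Suc r)) > 0 \<and>
    (\<forall>x\<in>{r+2..n}. p (\<sigma> x) > 0) \<and>
    (\<forall>x\<in>{n+1..k}. (\<Sum>i\<in>{1..r}. of_bool (\<sigma> x \<in> F i)) + h (\<sigma> x) + 2 * p (\<sigma> x) < n - r)"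
proof -
  define m where "m = n - r"
  have n: "n = r + m" and m: "m > 0" using rn by (simp_all add: m_def)
  define f :: "nat \<Rightarrow> nat" where "f l = (\<Sum>i\<in>{1..r}. of_bool (l \<in> F i))" for l
  define dg where "dg l = f l + h l + 2 * p l" for l
  have F: "F i \<subseteq> {1..k}" "card (F i) = m" if "i \<in> {1..r}" for i
    using out that by (auto simp: outline_def m_def)
  have sum_h: "(\<Sum>l\<in>{1..k}. h l) = m" and sum_p: "(\<Sum>l\<in>{1..k}. 2 * p l) = m * (m - 1)"
    and dg_le: "\<And>l. l \<in> {1..k} \<Longrightarrow> dg l \<le> m"
    using out by (auto simp: outline_def m_def dg_def f_def)
  have row_F: "(\<Sum>l\<in>{1..k}. of_bool (l \<in> F i)) = m"
    and row_F_real: "(\<Sum>l\<in>{1..k}. of_bool (l \<in> F i)) = real m" if "i \<in> {1..r}" for i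
  proof -
    have "{1..k} \<inter> {l. l \<in> F i} = F i" using F(1)[OF that] by blast
    then show "(\<Sum>l\<in>{1..k}. of_bool (l \<in> F i)) = m" "(\<Sum>l\<in>{1..k}. of_bool (l \<in> F i)) = real m"
      using F(2)[OF that] by (simp_all add: sum_of_bool_eq)
  qed
  have "(\<Sum>l\<in>{1..k}. f l) = (\<Sum>i\<in>{1..r}. \<Sum>l\<in>{1..k}. of_bool (l \<in> F i))"
    unfolding f_def by (rule sum.swap)
  also have "\<dots> = r * m" using row_F by simp
  finally have "(\<Sum>l\<in>{1..k}. dg l) = r * m + m + m * (m - 1)"
    using sum_h sum_p by (simp add: dg_def sum.distrib)
  also have "\<dots> = n * m" using n m by (cases m) (simp_all add: algebra_simps)
  \<comment> \<open>The \<open>k\<close> symbols have capacity \<open>m\<close> each, so their total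
    slack is \<open>(k - n) * m\<close>, as much as \<open>k - n\<close> dummy positions of weight
    \<open>m\<close> require.\<close>
  finally have sum_dg: "(\<Sum>l\<in>{1..k}. dg l) = n * m" .
  \<comment> \<open>Every position has total weight \<open>m\<close>: the \<open>m - 1\<close>
    off-diagonal positions share the total \<open>m * (m - 1)\<close> of \<open>2 * p\<close>
    equally, and the dummies share the slack. Every symbol receives its degree \<open>dg l\<close>
    plus its slack \<open>m - dg l\<close>. A denominator vanishes only if the corresponding range
    of positions is empty.\<close>
  define w :: "nat \<Rightarrow> nat \<Rightarrow> real" where
    "w x l = (if x \<le> r then of_bool (l \<in> F x) else if x = Suc r then h l
       else if x \<le> n then 2 * real (p l) / (real m - 1)
       else (real m - real (dg l)) / (real k - real n))" for x l
  have split: "{1..k} = {1..r} \<union> ({Suc r} \<union> ({r+2..n} \<union> {n+1..k}))"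
    using rn nk by auto
  have "\<exists>\<sigma>. bij_betw \<sigma> {1..k} {1..k} \<and> (\<forall>x\<in>{1..k}. w x (\<sigma> x) > 0)"
  proof (rule doubly_stochastic_bij)
    show "real m > 0" using m by simp
    show "w x l \<ge> 0" if "x \<in> {1..k}" "l \<in> {1..k}" for x l
      using dg_le[OF that(2)] m that nk by (auto simp: w_def)
    show "(\<Sum>l\<in>{1..k}. w x l) = m" if x: "x \<in> {1..k}" for x
    proof -
      consider "x \<in> {1..r}" | "x = Suc r" | "x \<in> {r+2..n}" | "x \<in> {n+1..k}"
        using x split by blast
      then show ?thesis
      proof cases
        case 1
        then show ?thesis using row_F_real[OF 1] by (simp add: w_def)
      next
        case 2
        then show ?thesis using sum_h by (simp add: w_def flip: of_nat_sum)
      next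
        case 3
        then have "(\<Sum>l\<in>{1..k}. w x l) = real (\<Sum>l\<in>{1..k}. 2 * p l) / real (m - 1)"
          using m by (simp add: w_def sum_divide_distrib of_nat_diff)
        then show ?thesis using 3 unfolding sum_p by (simp add: m_def)
      next
        case 4
        then have "(\<Sum>l\<in>{1..k}. w x l) = (\<Sum>l\<in>{1..k}. real m - real (dg l)) / (real k - real n)"
          using rn by (simp add: w_def sum_divide_distrib)
        also have "(\<Sum>l\<in>{1..k}. real m - real (dg l)) = real k * real m - real (\<Sum>l\<in>{1..k}. dg l)"
          by (simp add: sum_subtractf)
        also have "\<dots> = (real k - real n) * m" unfolding sum_dg by (simp add: algebra_simps)
        finally show ?thesis using 4 by simp
      qed
    qed
    show "(\<Sum>x\<in>{1..k}. w x l) = m" if l: "l \<in> {1..k}" for l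
    proof -
      have "(\<Sum>x\<in>{1..r}. w x l) = f l" by (simp add: w_def f_def)
      moreover have "w (Suc r) l = h l" by (simp add: w_def)
      moreover have "(\<Sum>x\<in>{r+2..n}. w x l) = 2 * p l"
      proof (cases "m = 1")
        case True
        then have "p l = 0" using sum_p l by simp
        then show ?thesis using rn by (simp add: w_def)
      next
        case False
        have "(\<Sum>x\<in>{r+2..n}. w x l) = (\<Sum>x\<in>{r+2..n}. 2 * p l / (real m - 1))"
          by (intro sum.cong) (auto simp: w_def)
        also have "\<dots> = real (m - 1) * (2 * p l / (real m - 1))"
          using rn by (simp add: m_def)
        finally show ?thesis using False m by (simp add: of_nat_diff)
      qed
      moreover have "(\<Sum>x\<in>{n+1..k}. w x l) = real m - real (dg l)"
      proof (cases "k = n")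
        \<comment> \<open>With no dummy position to absorb slack there must be none: the average of
          \<open>dg\<close> is \<open>m\<close>, which is also its upper bound.\<close>
        case True
        have "dg l = m"
        proof (rule ccontr)
          assume "dg l \<noteq> m"
          then have "dg l < m" using dg_le[OF l] by simp
          then have "(\<Sum>l\<in>{1..k}. dg l) < (\<Sum>l\<in>{1..k}. m)"
            using dg_le l by (intro sum_strict_mono_ex1) auto
          then show False using sum_dg True by simp
        qed
        then show ?thesis using True by simp
      next
        case False
        have "(\<Sum>x\<in>{n+1..k}. w x l) = (\<Sum>x\<in>{n+1..k}. (real m - real (dg l)) / (real k - real n))"
          using rn by (intro sum.cong) (auto simp: w_def)
        then show ?thesis using False nk by (simp add: of_nat_diff)
      qed
      moreover have disj: "{1..r} \<inter> ({Suc r} \<union> ({r+2..n} \<union> {n+1..k})) = {}"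
        "{Suc r} \<inter> ({r+2..n} \<union> {n+1..k}) = {}" "{r+2..n} \<inter> {n+1..k} = {}"
        using rn by auto
      moreover have "(\<Sum>x\<in>{1..k}. w x l) = (\<Sum>x\<in>{1..r}. w x l) + (w (Suc r) l +
          ((\<Sum>x\<in>{r+2..n}. w x l) + (\<Sum>x\<in>{n+1..k}. w x l)))"
        unfolding split
        by (simp only: sum.union_disjoint finite_Un finite_atLeastAtMost finite.intros disj) simp
      ultimately show ?thesis by (simp add: dg_def)
    qed
  qed auto
  then obtain \<sigma> where \<sigma>: "bij_betw \<sigma> {1..k} {1..k}" "\<And>x. x \<in> {1..k} \<Longrightarrow> w x (\<sigma> x) > 0" by blast
  have "\<sigma> i \<in> F i" if "i \<in> {1..r}" for i
    using \<sigma>(2)[of i] that rn nk by (auto simp: w_def split: if_splits)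
  moreover have "h (\<sigma> (Suc r)) > 0"
    using \<sigma>(2)[of "Suc r"] rn nk by (auto simp: w_def)
  moreover have "p (\<sigma> x) > 0" if "x \<in> {r+2..n}" for x
    using \<sigma>(2)[of x] that nk by (cases "p (\<sigma> x)") (auto simp: w_def)
  moreover have "dg (\<sigma> x) < m" if "x \<in> {n+1..k}" for x
    using \<sigma>(2)[of x] that rn by (auto simp: w_def zero_less_divide_iff)
  ultimately show ?thesis using \<sigma>(1) unfolding dg_def f_def m_def by blast
qed

text \<open>The degree \<open>f + h + 2 * p\<close> of a symbol has to fit into one row less. If
  \<open>l = \<sigma> x\<close>, a position \<open>x \<le> r\<close> lowers \<open>f\<close> by one
  and the diagonal position lowers \<open>h\<close> by one. A later position up to \<open>n\<close>
  lowers \<open>2 * p\<close> by two, but the new row adds one to \<open>f\<close>. At a dummy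
  position nothing changes, but there the old bound was strict.\<close>

lemma outline_step:
  assumes out: "outline n k \<rho> r L F h p" and rn: "r < n" and nk: "n \<le> k"
  shows "\<exists>L' F' h' p'. outline n k \<rho> (Suc r) L' F' h' p' \<and> top_left_subarray r L L' \<and>
    (\<forall>l\<in>{1..k}. h l = h' l + of_bool (L' (Suc r) (Suc r) = l))"
proof -
  obtain \<sigma> where \<sigma>: "bij_betw \<sigma> {1..k} {1..k}"
    and \<sigma>F: "\<And>i. i \<in> {1..r} \<Longrightarrow> \<sigma> i \<in> F i"
    and \<sigma>h: "h (\<sigma> (Suc r)) > 0"
    and \<sigma>p: "\<And>x. x \<in> {r+2..n} \<Longrightarrow> p (\<sigma> x) > 0"
    and \<sigma>dummy: "\<And>x. x \<in> {n+1..k} \<Longrightarrow>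
        (\<Sum>i\<in>{1..r}. of_bool (\<sigma> x \<in> F i)) + h (\<sigma> x) + 2 * p (\<sigma> x) < n - r"
    using outline_next_row[OF assms] by blast
  have inj: "inj_on \<sigma> {1..k}" and surj: "\<sigma> ` {1..k} = {1..k}"
    using bij_betw_imp_inj_on[OF \<sigma>] bij_betw_imp_surj_on[OF \<sigma>] by this+
  have \<sigma>_eq: "\<sigma> x = \<sigma> y \<longleftrightarrow> x = y" if "x \<in> {1..k}" "y \<in> {1..k}" for x y
    using inj_on_eq_iff[OF inj that] .
  have inj_sub: "inj_on \<sigma> Z" and im_sub: "\<sigma> ` Z \<subseteq> {1..k}" if "Z \<subseteq> {1..k}" for Z
    using inj_on_subset[OF inj that] image_mono[OF that, of \<sigma>] surj by simp_all
  have sub: "{1..r} \<subseteq> {1..k}" "{1..Suc r} \<subseteq> {1..k}" "{r+2..n} \<subseteq> {1..k}"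
    using rn nk by auto
  note out' = out[unfolded outline_def]
  have sym: "symmetric_array r L" using out' by blast
  have lat: "L i ` {1..r} \<subseteq> {1..k}" "inj_on (L i) {1..r}" if "i \<in> {1..r}" for i
    using out' that unfolding filled_latin_iff_inj_on[OF sym] by blast+
  have F: "F i \<subseteq> {1..k}" "card (F i) = n - r" "F i \<inter> L i ` {1..r} = {}" if "i \<in> {1..r}" for i
    using out' that by blast+
  have sum_h: "(\<Sum>l\<in>{1..k}. h l) = n - r"
    and sum_p: "(\<Sum>l\<in>{1..k}. 2 * p l) = (n - r) * (n - r - 1)"
    using out' by blast+
  have deg: "(\<Sum>i\<in>{1..r}. of_bool (l \<in> F i)) + h l + 2 * p l \<le> n - r"
    and occ: "occurrences r L l + 2 * (\<Sum>i\<in>{1..r}. of_bool (l \<in> F i)) + h l + 2 * p l = \<rho> l"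
    if "l \<in> {1..k}" for l
    using out' that by blast+
  \<comment> \<open>If exactly one of the indices is \<open>Suc r\<close>, then
    \<open>min i j\<close> is the other, so \<sigma> serves as the new row and as the new column; on
    the new diagonal cell it is \<open>Suc r\<close>.\<close>
  define L' where "L' i j = (if i \<le> r \<and> j \<le> r then L i j else \<sigma> (min i j))" for i j
  \<comment> \<open>For the new row: each symbol at a position in \<open>{r+2..n}\<close> gives up
    one pair counted by \<open>p\<close>, and \<open>F'\<close> counts that pair from now
    on.\<close>
  define F' where "F' i = (if i \<le> r then F i - {\<sigma> i} else \<sigma> ` {r+2..n})" for i
  define h' where "h' l = h l - of_bool (\<sigma> (Suc r) = l)" for l
  define p' where "p' l = p l - of_bool (l \<in> \<sigma> ` {r+2..n})" for l
  have h'_eq: "h l = h' l + of_bool (\<sigma> (Suc r) = l)" for l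
    using \<sigma>h by (auto simp: h'_def)
  have p'_eq: "p l = p' l + of_bool (l \<in> \<sigma> ` {r+2..n})" for l
    using \<sigma>p by (force simp: p'_def)
  have f_eq: "(\<Sum>i\<in>{1..r}. of_bool (l \<in> F i)) =
      (\<Sum>i\<in>{1..r}. of_bool (l \<in> F' i)) + (of_bool (l \<in> \<sigma> ` {1..r}) :: nat)" for l
  proof -
    have "inj_on \<sigma> {1..r}" by (rule inj_sub[OF sub(1)])
    then have "of_bool (l \<in> \<sigma> ` {1..r}) = (\<Sum>i\<in>{1..r}. of_bool (\<sigma> i = l) :: nat)"
      using sum_of_bool_eq_image[of \<sigma> "{1..r}" l] by simp
    then show ?thesis unfolding sum.distrib[symmetric]
      using \<sigma>F by (simp only: sum.distrib[symmetric]) (intro sum.cong; auto simp: F'_def)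
  qed
  have f'_Suc: "(\<Sum>i\<in>{1..Suc r}. of_bool (l \<in> F' i)) =
      (\<Sum>i\<in>{1..r}. of_bool (l \<in> F' i)) + (of_bool (l \<in> \<sigma> ` {r+2..n}) :: nat)" for l
    by (simp add: F'_def del: sum_of_bool_eq)
  have sym': "symmetric_array (Suc r) L'"
    using sym by (auto simp: symmetric_array_def L'_def min.commute)
  have row: "L' i ` {1..Suc r} = insert (\<sigma> i) (L i ` {1..r})" if "i \<in> {1..r}" for i
    using that by (auto simp: L'_def image_iff atLeastAtMostSuc_conv)
  have row_Suc: "L' (Suc r) ` {1..Suc r} = \<sigma> ` {1..Suc r}"
    by (intro image_cong) (auto simp: L'_def)
  have "outline n k \<rho> (Suc r) L' F' h' p'"
    unfolding outline_def
  proof (intro conjI ballI)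
    show "filled_latin (Suc r) k L'" unfolding filled_latin_iff_inj_on[OF sym']
    proof (intro ballI conjI)
      fix i assume i: "i \<in> {1..Suc r}"
      show "L' i ` {1..Suc r} \<subseteq> {1..k}"
      proof (cases "i = Suc r")
        case True
        then show ?thesis using row_Suc im_sub[OF sub(2)] by (simp only:)
      next
        case False
        then have "i \<in> {1..r}" using i by auto
        then show ?thesis unfolding row[OF \<open>i \<in> {1..r}\<close>] using lat(1) \<sigma>F F(1) by blast
      qed
      show "inj_on (L' i) {1..Suc r}"
      proof (cases "i = Suc r")
        case True
        have "inj_on (L' (Suc r)) {1..Suc r} \<longleftrightarrow> inj_on \<sigma> {1..Suc r}"
          by (rule inj_on_cong) (simp add: L'_def)
        then show ?thesis using True inj_sub[OF sub(2)] by simp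
      next
        case False
        then have ir: "i \<in> {1..r}" using i by auto
        have "inj_on (L' i) {1..r} \<longleftrightarrow> inj_on (L i) {1..r}"
          by (rule inj_on_cong) (use ir in \<open>simp add: L'_def\<close>)
        then have "inj_on (L' i) {1..r}" using lat(2)[OF ir] by simp
        moreover have "L' i (Suc r) \<notin> L' i ` {1..r}"
          using \<sigma>F[OF ir] F(3)[OF ir] ir by (auto simp: L'_def image_iff)
        ultimately show ?thesis by (simp add: atLeastAtMostSuc_conv)
      qed
    qed
    show "symmetric_array (Suc r) L'" by (rule sym')
    fix i assume i: "i \<in> {1..Suc r}"
    show "F' i \<subseteq> {1..k}"
      using i F(1)[of i] im_sub[OF sub(3)] by (cases "i \<le> r") (auto simp: F'_def)
    show "card (F' i) = n - Suc r"
    proof (cases "i \<le> r")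
      case True
      then show ?thesis using i F(2)[of i] \<sigma>F[of i] by (simp add: F'_def)
    next
      case False
      have "inj_on \<sigma> {r+2..n}" by (rule inj_sub[OF sub(3)])
      then show ?thesis using False by (simp add: F'_def card_image)
    qed
    show "F' i \<inter> L' i ` {1..Suc r} = {}"
    proof (cases "i = Suc r")
      case True
      have "\<sigma> ` {r+2..n} \<inter> \<sigma> ` {1..Suc r} = \<sigma> ` ({r+2..n} \<inter> {1..Suc r})"
        by (rule inj_on_image_Int[OF inj sub(3,2), symmetric])
      also have "{r+2..n} \<inter> {1..Suc r} = {}" by auto
      finally show ?thesis using row_Suc True by (simp add: F'_def)
    next
      case False
      then have ir: "i \<in> {1..r}" using i by auto
      then show ?thesis unfolding row[OF ir] using F(3)[OF ir] by (auto simp: F'_def)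
    qed
  next
    have "(\<Sum>l\<in>{1..k}. h l) = (\<Sum>l\<in>{1..k}. h' l) + (\<Sum>l\<in>{1..k}. of_bool (\<sigma> (Suc r) = l))"
      unfolding h'_eq by (rule sum.distrib)
    also have "(\<Sum>l\<in>{1..k}. of_bool (\<sigma> (Suc r) = l)) = (1 :: nat)"
      using im_sub[of "{Suc r}"] rn nk by simp
    finally show "(\<Sum>l\<in>{1..k}. h' l) = n - Suc r" using sum_h by simp
  next
    have "inj_on \<sigma> {r+2..n}" by (rule inj_sub[OF sub(3)])
    moreover have "{1..k} \<inter> {l. l \<in> \<sigma> ` {r+2..n}} = \<sigma> ` {r+2..n}" using im_sub[OF sub(3)] by blast
    ultimately have "(\<Sum>l\<in>{1..k}. of_bool (l \<in> \<sigma> ` {r+2..n})) = n - r - 1"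
      by (simp add: sum_of_bool_eq card_image)
    moreover have "(\<Sum>l\<in>{1..k}. 2 * p l) =
        (\<Sum>l\<in>{1..k}. 2 * p' l) + 2 * (\<Sum>l\<in>{1..k}. of_bool (l \<in> \<sigma> ` {r+2..n}))"
      unfolding p'_eq sum_distrib_left sum.distrib[symmetric] by (simp add: algebra_simps)
    ultimately have "(n - r) * (n - r - 1) = (\<Sum>l\<in>{1..k}. 2 * p' l) + 2 * (n - r - 1)"
      using sum_p by simp
    \<comment> \<open>The claim is \<open>(t + 1) * t - 2 * t = t * (t - 1)\<close>, with
      \<open>t = 0\<close> apart because of truncated subtraction.\<close>
    moreover obtain t where "n = r + 1 + t" using rn by (metis Suc_eq_plus1 Suc_leI le_Suc_ex)
    ultimately show "(\<Sum>l\<in>{1..k}. 2 * p' l) = (n - Suc r) * (n - Suc r - 1)"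
      by (cases t) (auto simp: algebra_simps)
  next
    fix l assume l: "l \<in> {1..k}"
    obtain x where x: "x \<in> {1..k}" "l = \<sigma> x" using l surj by blast
    have mem: "\<sigma> x \<in> \<sigma> ` Z \<longleftrightarrow> x \<in> Z" if "Z \<subseteq> {1..k}" for Z
      using inj x(1) that by (rule inj_on_image_mem_iff)
    have used: "l \<in> \<sigma> ` {1..r} \<longleftrightarrow> x \<in> {1..r}" "l \<in> \<sigma> ` {r+2..n} \<longleftrightarrow> x \<in> {r+2..n}"
      unfolding x(2) by (rule mem[OF sub(1)], rule mem[OF sub(3)])
    have "Suc r \<in> {1..k}" using rn nk by simp
    then have used_diag: "\<sigma> (Suc r) = l \<longleftrightarrow> x = Suc r" unfolding x(2) using \<sigma>_eq x(1) by metis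
    show "(\<Sum>i\<in>{1..Suc r}. of_bool (l \<in> F' i)) + h' l + 2 * p' l \<le> n - Suc r"
    proof (cases "x \<le> n")
      case True
      then have "x \<in> {1..r} \<or> x = Suc r \<or> x \<in> {r+2..n}" using x(1) by auto
      then show ?thesis
        using deg[OF l] unfolding f'_Suc f_eq h'_eq[of l] p'_eq[of l] used used_diag by auto
    next
      case False
      then have "x \<in> {n+1..k}" using x(1) by auto
      then show ?thesis
        using \<sigma>dummy[of x] False rn unfolding x(2)[symmetric] f'_Suc f_eq h'_eq[of l] p'_eq[of l] used used_diag
        by auto
    qed
    have "(\<Sum>i\<in>{1..r}. of_bool (L' i (Suc r) = l)) = (of_bool (l \<in> \<sigma> ` {1..r}) :: nat)"
    proof -
      have "inj_on \<sigma> {1..r}" by (rule inj_sub[OF sub(1)])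
      then have "(\<Sum>i\<in>{1..r}. of_bool (\<sigma> i = l)) = (of_bool (l \<in> \<sigma> ` {1..r}) :: nat)"
        by (rule sum_of_bool_eq_image) simp
      moreover have "(\<Sum>i\<in>{1..r}. of_bool (L' i (Suc r) = l)) = (\<Sum>i\<in>{1..r}. of_bool (\<sigma> i = l) :: nat)"
        by (intro sum.cong) (auto simp: L'_def min_def)
      ultimately show ?thesis by simp
    qed
    moreover have "(\<Sum>j\<in>{1..r}. of_bool (L' (Suc r) j = l)) =
        (\<Sum>i\<in>{1..r}. of_bool (L' i (Suc r) = l) :: nat)"
      by (intro sum.cong) (auto simp: L'_def)
    moreover have "occurrences r L' l = occurrences r L l"
      unfolding occurrences_eq_sum by (intro sum.cong) (auto simp: L'_def)
    moreover have "L' (Suc r) (Suc r) = \<sigma> (Suc r)" by (simp add: L'_def)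
    ultimately show "occurrences (Suc r) L' l + 2 * (\<Sum>i\<in>{1..Suc r}. of_bool (l \<in> F' i))
        + h' l + 2 * p' l = \<rho> l"
      using occ[OF l] unfolding occurrences_Suc f'_Suc f_eq h'_eq[of l] p'_eq[of l] by simp
  qed
  moreover have "top_left_subarray r L L'" by (simp add: top_left_subarray_def L'_def)
  moreover have "\<forall>l\<in>{1..k}. h l = h' l + of_bool (L' (Suc r) (Suc r) = l)"
    using h'_eq by (simp add: L'_def)
  ultimately show ?thesis by blast
qed

lemma outline_completion:
  assumes "outline n k \<rho> r L F h p" and "r \<le> n" and "n \<le> k"
  shows "\<exists>L'. rho_latin_square n k \<rho> L' \<and> symmetric_array n L' \<and> top_left_subarray r L L' \<and>
    (\<forall>l\<in>{1..k}. card {i \<in> {r+1..n}. L' i i = l} = h l)"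
  using assms
proof (induction "n - r" arbitrary: r L F h p)
  case 0
  \<comment> \<open>The degree bound \<open>n - r = 0\<close> makes all multiplicities vanish, so
    \<open>L\<close> itself has the required occurrences.\<close>
  then have "r = n" by simp
  then show ?case using "0.prems"
    by (intro exI[of _ L]) (auto simp: outline_def rho_latin_square_def top_left_subarray_def)
next
  case (Suc m)
  then have rn: "r < n" by simp
  obtain L1 F1 h1 p1 where 1: "outline n k \<rho> (Suc r) L1 F1 h1 p1" "top_left_subarray r L L1"
    "\<forall>l\<in>{1..k}. h l = h1 l + of_bool (L1 (Suc r) (Suc r) = l)"
    using outline_step[OF Suc.prems(1) rn Suc.prems(3)] by blast
  have "m = n - Suc r" using Suc.hyps by simp
  from Suc.hyps(1)[OF this 1(1)] obtain L' where L': "rho_latin_square n k \<rho> L'" "symmetric_array n L'"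
    "top_left_subarray (Suc r) L1 L'" "\<forall>l\<in>{1..k}. card {i \<in> {Suc r+1..n}. L' i i = l} = h1 l"
    using rn Suc.prems(3) by auto
  have "card {i \<in> {r+1..n}. L' i i = l} = h l" if l: "l \<in> {1..k}" for l
  proof -
    have "{r+1..n} = insert (Suc r) {Suc r+1..n}" using rn by auto
    then have "card {i \<in> {r+1..n}. L' i i = l} =
        of_bool (L' (Suc r) (Suc r) = l) + card {i \<in> {Suc r+1..n}. L' i i = l}"
      by (simp only: card_eq_sum_of_bool finite_atLeastAtMost finite_insert) simp
    then show ?thesis using 1(3) L'(3,4) l by (simp add: top_left_subarray_def)
  qed
  moreover have "top_left_subarray r L L'"
    using 1(2) L'(3) by (simp add: top_left_subarray_def)
  ultimately show ?case using L' by blast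
qed

section \<open>Parity, missing symbols and the two families of inequalities\<close>

text \<open>Off-diagonal occurrences come in transposed pairs.\<close>

lemma symmetric_occurrences_parity:
  assumes "symmetric_array m A"
  shows "even (occurrences m A l + card {i \<in> {1..m}. A i i = l})"
  using assms
proof (induction m)
  case 0
  then show ?case by (simp add: occurrences_eq_sum)
next
  case (Suc m)
  then have "even (occurrences m A l + card {i \<in> {1..m}. A i i = l})"
    by (simp add: symmetric_array_def)
  moreover have "(\<Sum>j\<in>{1..m}. of_bool (A (Suc m) j = l)) = (\<Sum>i\<in>{1..m}. of_bool (A i (Suc m) = l) :: nat)"
    using Suc.prems by (intro sum.cong) (auto simp: symmetric_array_def)
  moreover have "card {i \<in> {1..Suc m}. A i i = l} =
      card {i \<in> {1..m}. A i i = l} + of_bool (A (Suc m) (Suc m) = l)"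
    by (simp only: card_eq_sum_of_bool finite_atLeastAtMost) simp
  ultimately show ?case unfolding occurrences_Suc by auto
qed

lemma sum_occurrences:
  assumes "filled_latin m k A"
  shows "(\<Sum>l\<in>{1..k}. occurrences m A l) = m\<^sup>2"
proof -
  have "(\<Sum>l\<in>{1..k}. occurrences m A l)
      = (\<Sum>i\<in>{1..m}. \<Sum>l\<in>{1..k}. \<Sum>j\<in>{1..m}. of_bool (A i j = l))"
    unfolding occurrences_eq_sum by (rule sum.swap)
  also have "\<dots> = (\<Sum>i\<in>{1..m}. \<Sum>j\<in>{1..m}. \<Sum>l\<in>{1..k}. of_bool (A i j = l))"
    by (rule sum.cong[OF refl], rule sum.swap)
  also have "\<dots> = (\<Sum>i\<in>{1..m}. \<Sum>j\<in>{1..m}. 1)"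
  proof (intro sum.cong refl)
    fix i j assume "i \<in> {1..m}" "j \<in> {1..m}"
    then have "A i j \<in> {1..k}" using assms by (simp add: filled_latin_def)
    then show "(\<Sum>l\<in>{1..k}. of_bool (A i j = l)) = (1 :: nat)" by simp
  qed
  finally show ?thesis by (simp add: power2_eq_square)
qed

lemma mu_symbols_eq_sum:
  assumes "finite K"
  shows "mu_symbols r L K i = (\<Sum>l\<in>K. of_bool (l \<notin> L i ` {1..r}))"
proof -
  have "mu_symbols r L K i = card {l \<in> K. l \<notin> L i ` {1..r}}"
    unfolding mu_symbols_def by (rule arg_cong[where f = card]) blast
  then show ?thesis using card_eq_sum_of_bool[OF assms] by simp
qed

lemma mu_rows_eq_sum:
  assumes "finite I"
  shows "mu_rows r L I l = (\<Sum>i\<in>I. of_bool (l \<notin> L i ` {1..r}))"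
proof -
  have "mu_rows r L I l = card {i \<in> I. l \<notin> L i ` {1..r}}"
    unfolding mu_rows_def by (rule arg_cong[where f = card]) blast
  then show ?thesis using card_eq_sum_of_bool[OF assms] by simp
qed

lemma sum_mu_swap:
  assumes "finite I" and "finite K"
  shows "(\<Sum>i\<in>I. mu_symbols r L K i) = (\<Sum>l\<in>K. mu_rows r L I l)"
  unfolding mu_symbols_eq_sum[OF assms(2)] mu_rows_eq_sum[OF assms(1)] by (rule sum.swap)

text \<open>Both families of inequalities say that the same inequality holds for all \<open>K\<close> and \<open>I\<close>:
  the first one minimizes it over \<open>I\<close>, the second one maximizes it over \<open>K\<close>.\<close>

lemma min_condition_iff:
  fixes a :: "nat \<Rightarrow> int" and c :: int
  assumes S: "finite S"
  shows "(\<forall>K\<subseteq>S. (\<Sum>l\<in>K. max 0 (a l)) \<le> (\<Sum>i\<in>{1..r}. min c (int (mu_symbols r L K i)))) \<longleftrightarrow>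
    (\<forall>K\<subseteq>S. \<forall>I\<subseteq>{1..r}. (\<Sum>l\<in>K. max 0 (a l)) \<le> c * (int r - int (card I)) + (\<Sum>l\<in>K. int (mu_rows r L I l)))"
  (is "?A \<longleftrightarrow> ?C")
proof -
  \<comment> \<open>A row in \<open>I\<close> pays its missing symbols of \<open>K\<close>, any
    other row pays \<open>c\<close>; choosing \<open>I\<close> is choosing one of the two prices in
    each row.\<close>
  have key: "c * (int r - int (card I)) + (\<Sum>l\<in>K. int (mu_rows r L I l)) =
      (\<Sum>i\<in>{1..r}. if i \<in> I then int (mu_symbols r L K i) else c)"
    if K: "K \<subseteq> S" and I: "I \<subseteq> {1..r}" for K I
  proof -
    have finK: "finite K" and finI: "finite I" using K I S finite_subset by blast+
    have "int (card ({1..r} - I)) = int r - int (card I)"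
      using I finI card_mono[of "{1..r}" I] by (simp add: card_Diff_subset of_nat_diff)
    moreover have "(\<Sum>i\<in>I. int (mu_symbols r L K i)) = (\<Sum>l\<in>K. int (mu_rows r L I l))"
      using sum_mu_swap[OF finI finK] by (simp flip: of_nat_sum)
    moreover have "(\<Sum>i\<in>{1..r}. if i \<in> I then int (mu_symbols r L K i) else c) =
        (\<Sum>i\<in>I. int (mu_symbols r L K i)) + (\<Sum>i\<in>{1..r} - I. c)"
      using I by (simp add: sum.If_cases Diff_eq Int_absorb1)
    ultimately show ?thesis by simp
  qed
  show ?thesis
  proof
    assume A: ?A
    show ?C
    proof (intro allI impI)
      fix K I assume KI: "K \<subseteq> S" "I \<subseteq> {1..r}"
      have "(\<Sum>l\<in>K. max 0 (a l)) \<le> (\<Sum>i\<in>{1..r}. min c (int (mu_symbols r L K i)))"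
        using A KI by blast
      also have "\<dots> \<le> (\<Sum>i\<in>{1..r}. if i \<in> I then int (mu_symbols r L K i) else c)"
        by (intro sum_mono) simp
      finally show "(\<Sum>l\<in>K. max 0 (a l)) \<le> c * (int r - int (card I)) + (\<Sum>l\<in>K. int (mu_rows r L I l))"
        by (simp only: key[OF KI])
    qed
  next
    assume C: ?C
    show ?A
    proof (intro allI impI)
      fix K assume K: "K \<subseteq> S"
      \<comment> \<open>Takes the cheaper price in every row.\<close>
      define I where "I = {i \<in> {1..r}. int (mu_symbols r L K i) \<le> c}"
      have I: "I \<subseteq> {1..r}" by (auto simp: I_def)
      have "(\<Sum>l\<in>K. max 0 (a l)) \<le> c * (int r - int (card I)) + (\<Sum>l\<in>K. int (mu_rows r L I l))"
        using C K I by blast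
      also have "\<dots> = (\<Sum>i\<in>{1..r}. if i \<in> I then int (mu_symbols r L K i) else c)"
        by (rule key[OF K I])
      also have "\<dots> = (\<Sum>i\<in>{1..r}. min c (int (mu_symbols r L K i)))"
        by (intro sum.cong refl) (simp add: I_def min_def)
      finally show "(\<Sum>l\<in>K. max 0 (a l)) \<le> (\<Sum>i\<in>{1..r}. min c (int (mu_symbols r L K i)))" .
    qed
  qed
qed

lemma max_condition_iff:
  fixes a :: "nat \<Rightarrow> int" and c :: int
  assumes S: "finite S"
  shows "(\<forall>I\<subseteq>{1..r}. c * (int r - int (card I)) \<ge> (\<Sum>l\<in>S. max 0 (a l - int (mu_rows r L I l)))) \<longleftrightarrow>
    (\<forall>K\<subseteq>S. \<forall>I\<subseteq>{1..r}. (\<Sum>l\<in>K. max 0 (a l)) \<le> c * (int r - int (card I)) + (\<Sum>l\<in>K. int (mu_rows r L I l)))"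
  (is "?B \<longleftrightarrow> ?C")
proof
  assume B: ?B
  show ?C
  proof (intro allI impI)
    fix K I assume KI: "K \<subseteq> S" "I \<subseteq> {1..r}"
    have "(\<Sum>l\<in>K. max 0 (a l)) - (\<Sum>l\<in>K. int (mu_rows r L I l)) \<le> (\<Sum>l\<in>K. max 0 (a l - int (mu_rows r L I l)))"
      unfolding sum_subtractf[symmetric] by (intro sum_mono) simp
    also have "\<dots> \<le> (\<Sum>l\<in>S. max 0 (a l - int (mu_rows r L I l)))"
      using KI S by (intro sum_mono2) auto
    also have "\<dots> \<le> c * (int r - int (card I))" using B KI by blast
    finally show "(\<Sum>l\<in>K. max 0 (a l)) \<le> c * (int r - int (card I)) + (\<Sum>l\<in>K. int (mu_rows r L I l))"
      by simp
  qed
next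
  assume C: ?C
  show ?B
  proof (intro allI impI)
    fix I :: "nat set" assume I: "I \<subseteq> {1..r}"
    \<comment> \<open>For fixed \<open>I\<close>, the symbols with a positive term on the left; on
      them \<open>a l\<close> is positive too, so both maxima can be resolved.\<close>
    define K where "K = {l \<in> S. a l > int (mu_rows r L I l)}"
    have K: "K \<subseteq> S" by (auto simp: K_def)
    have "(\<Sum>l\<in>S. max 0 (a l - int (mu_rows r L I l))) = (\<Sum>l\<in>K. max 0 (a l - int (mu_rows r L I l)))"
      by (rule sum.mono_neutral_right) (use S in \<open>auto simp: K_def\<close>)
    also have "\<dots> = (\<Sum>l\<in>K. max 0 (a l) - int (mu_rows r L I l))"
      by (intro sum.cong) (auto simp: K_def)
    also have "\<dots> = (\<Sum>l\<in>K. max 0 (a l)) - (\<Sum>l\<in>K. int (mu_rows r L I l))"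
      by (rule sum_subtractf)
    also have "\<dots> \<le> c * (int r - int (card I))"
    proof -
      have "(\<Sum>l\<in>K. max 0 (a l)) \<le> c * (int r - int (card I)) + (\<Sum>l\<in>K. int (mu_rows r L I l))"
        using C K I by blast
      then show ?thesis by simp
    qed
    finally show "c * (int r - int (card I)) \<ge> (\<Sum>l\<in>S. max 0 (a l - int (mu_rows r L I l)))" .
  qed
qed

section \<open>Necessity\<close>

lemma occurrences_eq_rows:
  assumes "filled_latin m k A" and "symmetric_array m A"
  shows "occurrences m A l = (\<Sum>i\<in>{1..m}. of_bool (l \<in> A i ` {1..m}))"
  unfolding occurrences_eq_sum
proof (rule sum.cong[OF refl])
  fix i assume "i \<in> {1..m}"
  then have "inj_on (A i) {1..m}" using assms filled_latin_iff_inj_on by blast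
  then show "(\<Sum>j\<in>{1..m}. of_bool (A i j = l)) = (of_bool (l \<in> A i ` {1..m}) :: nat)"
    by (rule sum_of_bool_eq_image) simp
qed

lemma sum_of_bool_mem:
  assumes "finite K" and "S \<subseteq> K"
  shows "(\<Sum>l\<in>K. of_bool (l \<in> S)) = card S"
  using assms by (simp add: Int_absorb1)

text \<open>Rows of \<open>I\<close> can take \<open>l\<close> at most
  \<open>mu_rows r L I l\<close> times. The rest of the demand \<open>a l\<close> falls on the rows
  outside \<open>I\<close>, which have only \<open>c\<close> cells each.\<close>

lemma subgraph_imp_max_condition:
  fixes a :: "nat \<Rightarrow> int"
  assumes F: "\<And>i. i \<in> {1..r} \<Longrightarrow> F i \<subseteq> {1..k}" "\<And>i. i \<in> {1..r} \<Longrightarrow> card (F i) = c"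
      "\<And>i. i \<in> {1..r} \<Longrightarrow> F i \<inter> L i ` {1..r} = {}"
    and a: "\<And>l. l \<in> {1..k} \<Longrightarrow> a l \<le> int (\<Sum>i\<in>{1..r}. of_bool (l \<in> F i))"
    and I: "I \<subseteq> {1..r}"
  shows "(\<Sum>l\<in>{1..k}. max 0 (a l - int (mu_rows r L I l))) \<le> int c * (int r - int (card I))"
proof -
  have finI: "finite I" using I finite_subset by blast
  have "max 0 (a l - int (mu_rows r L I l)) \<le> int (\<Sum>i\<in>{1..r} - I. of_bool (l \<in> F i))"
    if l: "l \<in> {1..k}" for l
  proof -
    have "(\<Sum>i\<in>{1..r}. of_bool (l \<in> F i)) =
        (\<Sum>i\<in>{1..r} - I. of_bool (l \<in> F i)) + (\<Sum>i\<in>I. of_bool (l \<in> F i) :: nat)"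
      using I by (intro sum.subset_diff) simp_all
    moreover have "(\<Sum>i\<in>I. of_bool (l \<in> F i)) \<le> mu_rows r L I l"
      unfolding mu_rows_eq_sum[OF finI]
    proof (rule sum_mono)
      fix i assume "i \<in> I"
      then have "l \<notin> L i ` {1..r}" if "l \<in> F i" using F(3)[of i] I that by blast
      then show "of_bool (l \<in> F i) \<le> (of_bool (l \<notin> L i ` {1..r}) :: nat)"
        by (cases "l \<in> F i") simp_all
    qed
    ultimately show ?thesis using a[OF l] by linarith
  qed
  then have "(\<Sum>l\<in>{1..k}. max 0 (a l - int (mu_rows r L I l)))
      \<le> (\<Sum>l\<in>{1..k}. int (\<Sum>i\<in>{1..r} - I. of_bool (l \<in> F i)))"
    by (rule sum_mono)
  also have "\<dots> = int (\<Sum>l\<in>{1..k}. \<Sum>i\<in>{1..r} - I. of_bool (l \<in> F i))"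
    by (simp only: of_nat_sum)
  also have "(\<Sum>l\<in>{1..k}. \<Sum>i\<in>{1..r} - I. of_bool (l \<in> F i)) =
      (\<Sum>i\<in>{1..r} - I. \<Sum>l\<in>{1..k}. of_bool (l \<in> F i))"
    by (rule sum.swap)
  also have "\<dots> = (\<Sum>i\<in>{1..r} - I. c)"
  proof (rule sum.cong[OF refl])
    fix i assume "i \<in> {1..r} - I"
    then show "(\<Sum>l\<in>{1..k}. of_bool (l \<in> F i)) = c"
      using sum_of_bool_mem[OF finite_atLeastAtMost F(1)] F(2) by simp
  qed
  also have "int \<dots> = int c * (int r - int (card I))"
    using I finI card_mono[of "{1..r}" I] by (simp add: card_Diff_subset of_nat_diff)
  finally show ?thesis .
qed

lemma embeddable_imp_conditions:
  assumes rn: "r < n" and lat: "filled_latin r k L" and sym: "symmetric_array r L"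
    and emb: "symmetrically_embeddable r n k \<rho> d L"
  shows "(\<exists>t. n = r + (\<Sum>l\<in>{1..k}. d l) + card {l \<in> {1..k}. odd (\<rho> l + occurrences r L l + d l)} + 2 * t)"
    and "\<forall>I\<subseteq>{1..r}. (int n - int r) * (int r - int (card I)) \<ge>
      (\<Sum>l\<in>{1..k}. max 0 (int (\<rho> l) - int (occurrences r L l) - int n + int r - int (mu_rows r L I l)))"
proof -
  obtain L' where L': "filled_latin n k L'" "symmetric_array n L'"
    "\<And>l. l \<in> {1..k} \<Longrightarrow> occurrences n L' l = \<rho> l"
    "\<And>i j. i \<in> {1..r} \<Longrightarrow> j \<in> {1..r} \<Longrightarrow> L' i j = L i j"
    "\<And>l. l \<in> {1..k} \<Longrightarrow> d l \<le> card {i \<in> {r+1..n}. L' i i = l}"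
    using emb unfolding symmetrically_embeddable_def rho_latin_square_def top_left_subarray_def
      has_diagonal_tail_def by blast
  have inj: "inj_on (L' i) {1..n}" and im: "L' i ` {1..n} \<subseteq> {1..k}" if "i \<in> {1..n}" for i
    using L'(1) that unfolding filled_latin_iff_inj_on[OF L'(2)] by blast+
  have split: "{1..n} = {1..r} \<union> {r+1..n}" and disj: "{1..r} \<inter> {r+1..n} = {}"
    using rn by auto
  have sum_split: "(\<Sum>i\<in>{1..n}. g i) = (\<Sum>i\<in>{1..r}. g i) + (\<Sum>i\<in>{r+1..n}. g i)" for g :: "nat \<Rightarrow> nat"
    unfolding split by (rule sum.union_disjoint[OF _ _ disj]) simp_all
  have sub: "{1..r} \<subseteq> {1..n}" "{r+1..n} \<subseteq> {1..n}" using rn by auto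

  define h where "h l = card {i \<in> {r+1..n}. L' i i = l}" for l
  \<comment> \<open>Comparing the parities for \<open>L'\<close> and \<open>L\<close> cancels the
    diagonal of \<open>L\<close> and leaves the tail.\<close>
  have h_parity: "even (\<rho> l + occurrences r L l + h l)" if l: "l \<in> {1..k}" for l
  proof -
    have "(\<Sum>i\<in>{1..r}. of_bool (L' i i = l)) = (\<Sum>i\<in>{1..r}. of_bool (L i i = l) :: nat)"
      using L'(4) by (intro sum.cong) simp_all
    then have "card {i \<in> {1..n}. L' i i = l} = card {i \<in> {1..r}. L i i = l} + h l"
      unfolding h_def by (simp only: card_eq_sum_of_bool finite_atLeastAtMost sum_split)
    then show ?thesis
      using symmetric_occurrences_parity[OF L'(2), of l] symmetric_occurrences_parity[OF sym, of l]
        L'(3)[OF l] by auto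
  qed
  have "(\<Sum>l\<in>{1..k}. h l) = (\<Sum>l\<in>{1..k}. \<Sum>i\<in>{r+1..n}. of_bool (L' i i = l))"
    unfolding h_def by (simp only: card_eq_sum_of_bool finite_atLeastAtMost)
  also have "\<dots> = (\<Sum>i\<in>{r+1..n}. \<Sum>l\<in>{1..k}. of_bool (L' i i = l))" by (rule sum.swap)
  also have "\<dots> = (\<Sum>i\<in>{r+1..n}. 1)"
  proof (rule sum.cong[OF refl])
    fix i assume "i \<in> {r+1..n}"
    then have "L' i i \<in> {1..k}" using L'(1) rn by (simp add: filled_latin_def)
    then show "(\<Sum>l\<in>{1..k}. of_bool (L' i i = l)) = (1 :: nat)" by simp
  qed
  finally have "n = r + (\<Sum>l\<in>{1..k}. h l)" using rn by simp
  \<comment> \<open>The surplus \<open>h l - d l\<close> has the parity of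
    \<open>\<rho> l + e l + d l\<close>, so it is an even number plus one for each symbol counted by
    \<open>q\<close>.\<close>
  also have "(\<Sum>l\<in>{1..k}. h l) = (\<Sum>l\<in>{1..k}. d l + of_bool (odd (\<rho> l + occurrences r L l + d l))
      + 2 * ((h l - d l) div 2))"
  proof (rule sum.cong[OF refl])
    fix l assume l: "l \<in> {1..k}"
    obtain x where x: "h l = d l + x" using L'(5)[OF l] le_Suc_ex unfolding h_def by blast
    have "odd (\<rho> l + occurrences r L l + d l) \<longleftrightarrow> odd x" using h_parity[OF l] x by auto
    then show "h l = d l + of_bool (odd (\<rho> l + occurrences r L l + d l)) + 2 * ((h l - d l) div 2)"
      using x by (cases "odd x") (simp_all add: odd_two_times_div_two_succ)
  qed
  also have "\<dots> = (\<Sum>l\<in>{1..k}. d l) + card {l \<in> {1..k}. odd (\<rho> l + occurrences r L l + d l)}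
      + 2 * (\<Sum>l\<in>{1..k}. (h l - d l) div 2)"
    by (simp only: sum.distrib sum_distrib_left card_eq_sum_of_bool finite_atLeastAtMost)
  finally show "\<exists>t. n = r + (\<Sum>l\<in>{1..k}. d l) +
      card {l \<in> {1..k}. odd (\<rho> l + occurrences r L l + d l)} + 2 * t"
    unfolding add.assoc by (rule exI)

  define F where "F i = L' i ` {r+1..n}" for i
  have L_row: "L' i ` {1..r} = L i ` {1..r}" if "i \<in> {1..r}" for i
    using L'(4)[OF that] by (intro image_cong) simp_all
  have F: "F i \<subseteq> {1..k}" "card (F i) = n - r" "F i \<inter> L i ` {1..r} = {}" if i: "i \<in> {1..r}" for i
  proof -
    have i': "i \<in> {1..n}" using i sub(1) by blast
    show "F i \<subseteq> {1..k}" unfolding F_def using im[OF i'] sub(2) by blast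
    show "card (F i) = n - r"
      unfolding F_def using inj_on_subset[OF inj[OF i'] sub(2)] by (simp add: card_image)
    have "L' i ` {r+1..n} \<inter> L' i ` {1..r} = L' i ` ({r+1..n} \<inter> {1..r})"
      by (rule inj_on_image_Int[OF inj[OF i'] sub(2,1), symmetric])
    then show "F i \<inter> L i ` {1..r} = {}" unfolding F_def L_row[OF i, symmetric] using disj by auto
  qed
  have "int (\<rho> l) - int (occurrences r L l) - int n + int r \<le> int (\<Sum>i\<in>{1..r}. of_bool (l \<in> F i))"
    if l: "l \<in> {1..k}" for l
  proof -
    have row: "of_bool (l \<in> L' i ` {1..n}) = of_bool (l \<in> L i ` {1..r}) + (of_bool (l \<in> F i) :: nat)"
      if i: "i \<in> {1..r}" for i
    proof -
      have "L' i ` {1..n} = L i ` {1..r} \<union> F i"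
        unfolding split image_Un L_row[OF i] F_def ..
      then show ?thesis using F(3)[OF i] by (cases "l \<in> F i") auto
    qed
    have "\<rho> l = (\<Sum>i\<in>{1..n}. of_bool (l \<in> L' i ` {1..n}))"
      using L'(3)[OF l] occurrences_eq_rows[OF L'(1,2)] by simp
    also have "\<dots> = (\<Sum>i\<in>{1..r}. of_bool (l \<in> L' i ` {1..n})) + (\<Sum>i\<in>{r+1..n}. of_bool (l \<in> L' i ` {1..n}))"
      by (rule sum_split)
    also have "(\<Sum>i\<in>{1..r}. of_bool (l \<in> L' i ` {1..n})) =
        (\<Sum>i\<in>{1..r}. of_bool (l \<in> L i ` {1..r}) + (of_bool (l \<in> F i) :: nat))"
      by (rule sum.cong[OF refl row])
    also have "\<dots> = occurrences r L l + (\<Sum>i\<in>{1..r}. of_bool (l \<in> F i))"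
      unfolding occurrences_eq_rows[OF lat sym] by (rule sum.distrib)
    finally have "\<rho> l = occurrences r L l + (\<Sum>i\<in>{1..r}. of_bool (l \<in> F i))
        + (\<Sum>i\<in>{r+1..n}. of_bool (l \<in> L' i ` {1..n}))" .
    \<comment> \<open>Each of the last \<open>n - r\<close> rows holds \<open>l\<close> at most
      once.\<close>
    moreover have "(\<Sum>i\<in>{r+1..n}. of_bool (l \<in> L' i ` {1..n})) \<le> (\<Sum>i\<in>{r+1..n}. 1 :: nat)"
      by (rule sum_mono) simp
    then have "(\<Sum>i\<in>{r+1..n}. of_bool (l \<in> L' i ` {1..n})) \<le> n - r" by (simp only: sum_constant) simp
    ultimately show ?thesis using rn by linarith
  qed
  note max_condition = subgraph_imp_max_condition[OF F this]
  have "int (n - r) = int n - int r" using rn by simp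
  then show "\<forall>I\<subseteq>{1..r}. (int n - int r) * (int r - int (card I)) \<ge>
      (\<Sum>l\<in>{1..k}. max 0 (int (\<rho> l) - int (occurrences r L l) - int n + int r - int (mu_rows r L I l)))"
    using max_condition by simp
qed

section \<open>Sufficiency\<close>

lemma conditions_imp_embeddable:
  assumes rn: "r < n" and nk: "n \<le> k" and \<rho>n: "\<And>l. l \<in> {1..k} \<Longrightarrow> \<rho> l \<le> n"
    and sum_\<rho>: "(\<Sum>l\<in>{1..k}. \<rho> l) = n\<^sup>2"
    and lat: "filled_latin r k L" and sym: "symmetric_array r L"
    and room: "\<And>l. l \<in> {1..k} \<Longrightarrow> 2 * r + d l \<le> \<rho> l + occurrences r L l"
    and t: "n = r + (\<Sum>l\<in>{1..k}. d l) + card {l \<in> {1..k}. odd (\<rho> l + occurrences r L l + d l)} + 2 * t"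
    and cond: "\<And>K I. K \<subseteq> {1..k} \<Longrightarrow> I \<subseteq> {1..r} \<Longrightarrow>
      (\<Sum>l\<in>K. max 0 (int (\<rho> l) - int (occurrences r L l) - int n + int r))
        \<le> (int n - int r) * (int r - int (card I)) + (\<Sum>l\<in>K. int (mu_rows r L I l))"
  shows "symmetrically_embeddable r n k \<rho> d L"
proof -
  define e where "e l = occurrences r L l" for l
  \<comment> \<open>Truncated subtraction supplies the maximum with 0.\<close>
  define a where "a l = \<rho> l + r - (e l + n)" for l
  define E where "E i l \<longleftrightarrow> l \<notin> L i ` {1..r}" for i l
  have inj: "inj_on (L i) {1..r}" and im: "L i ` {1..r} \<subseteq> {1..k}" if "i \<in> {1..r}" for i
    using lat that unfolding filled_latin_iff_inj_on[OF sym] by blast+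
  have card_E: "card {i \<in> {1..r}. E i l} + e l = r" for l
  proof -
    have "card {i \<in> {1..r}. E i l} + e l
        = (\<Sum>i\<in>{1..r}. of_bool (E i l) + (of_bool (l \<in> L i ` {1..r}) :: nat))"
      unfolding e_def occurrences_eq_rows[OF lat sym]
      by (simp only: card_eq_sum_of_bool finite_atLeastAtMost sum.distrib)
    also have "\<dots> = (\<Sum>i\<in>{1..r}. 1)" by (intro sum.cong) (auto simp: E_def)
    finally show ?thesis by simp
  qed
  have "\<exists>F. (\<forall>i\<in>{1..r}. F i \<subseteq> {l \<in> {1..k}. E i l} \<and> card (F i) \<le> n - r) \<and>
      (\<forall>l\<in>{1..k}. a l \<le> card {i \<in> {1..r}. l \<in> F i})"
  proof (rule bipartite_subgraph_degrees)
    \<comment> \<open>\<open>l\<close> is missing from \<open>r - e l\<close> rows, and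
      \<open>\<rho> l \<le> n\<close> keeps the demand within that number.\<close>
    show "a l \<le> card {i \<in> {1..r}. E i l}" if "l \<in> {1..k}" for l
      using card_E[of l] \<rho>n[OF that] unfolding a_def by linarith
    show "(\<Sum>l\<in>K. a l) \<le> (n - r) * card ({1..r} - I) + (\<Sum>l\<in>K. card {i \<in> I. E i l})"
      if I: "I \<subseteq> {1..r}" and K: "K \<subseteq> {1..k}" for I K
    proof -
      have finI: "finite I" using I finite_subset by blast
      have "mu_rows r L I l = card {i \<in> I. E i l}" for l
        unfolding mu_rows_eq_sum[OF finI] E_def using card_eq_sum_of_bool[OF finI] by simp
      then have mu: "(\<Sum>l\<in>K. int (mu_rows r L I l)) = int (\<Sum>l\<in>K. card {i \<in> I. E i l})"
        by simp
      have "int (\<Sum>l\<in>K. a l) = (\<Sum>l\<in>K. max 0 (int (\<rho> l) - int (occurrences r L l) - int n + int r))"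
        unfolding of_nat_sum by (intro sum.cong refl) (simp add: a_def e_def)
      also have "\<dots> \<le> (int n - int r) * (int r - int (card I)) + int (\<Sum>l\<in>K. card {i \<in> I. E i l})"
        using cond[OF K I] unfolding mu .
      also have "(int n - int r) * (int r - int (card I)) = int ((n - r) * card ({1..r} - I))"
        using rn I finI card_mono[of "{1..r}" I] by (simp add: card_Diff_subset of_nat_diff)
      finally show ?thesis by linarith
    qed
  qed simp_all
  then obtain F0 where "(\<forall>i\<in>{1..r}. F0 i \<subseteq> {l \<in> {1..k}. E i l} \<and> card (F0 i) \<le> n - r) \<and>
      (\<forall>l\<in>{1..k}. a l \<le> card {i \<in> {1..r}. l \<in> F0 i})"
    by (rule exE)
  note * = conjunct1[OF this, rule_format] conjunct2[OF this, rule_format]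
  have F0: "F0 i \<subseteq> {l \<in> {1..k}. E i l}" "card (F0 i) \<le> n - r" if "i \<in> {1..r}" for i
    using *(1)[OF that] by (rule conjunct1, rule conjunct2)
  note F0_deg = *(2)
  \<comment> \<open>A row misses \<open>k - r \<ge> n - r\<close> symbols, so it can be filled up;
    this only increases the degrees of symbols, for which \<open>F0\<close> gives lower
    bounds.\<close>
  have "\<forall>i\<in>{1..r}. \<exists>S. F0 i \<subseteq> S \<and> S \<subseteq> {l \<in> {1..k}. E i l} \<and> card S = n - r"
  proof
    fix i assume i: "i \<in> {1..r}"
    have "{l \<in> {1..k}. E i l} = {1..k} - L i ` {1..r}" by (auto simp: E_def)
    then have "card {l \<in> {1..k}. E i l} = k - r"
      using im[OF i] inj[OF i] by (simp add: card_Diff_subset card_image)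
    then have "n - r \<le> card {l \<in> {1..k}. E i l}" using nk by simp
    then show "\<exists>S. F0 i \<subseteq> S \<and> S \<subseteq> {l \<in> {1..k}. E i l} \<and> card S = n - r"
      using exists_subset_between[OF F0(2)[OF i] _ F0(1)[OF i]] by simp
  qed
  then obtain F where F: "\<And>i. i \<in> {1..r} \<Longrightarrow> F0 i \<subseteq> F i"
    "\<And>i. i \<in> {1..r} \<Longrightarrow> F i \<subseteq> {l \<in> {1..k}. E i l}" "\<And>i. i \<in> {1..r} \<Longrightarrow> card (F i) = n - r"
    by metis
  define f :: "nat \<Rightarrow> nat" where "f l = (\<Sum>i\<in>{1..r}. of_bool (l \<in> F i))" for l
  have f_card: "f l = card {i \<in> {1..r}. l \<in> F i}" for l
    unfolding f_def by (simp only: card_eq_sum_of_bool finite_atLeastAtMost)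
  have f_ge: "\<rho> l + r \<le> e l + n + f l" if l: "l \<in> {1..k}" for l
  proof -
    have "card {i \<in> {1..r}. l \<in> F0 i} \<le> f l"
      unfolding f_card using F(1) by (intro card_mono) auto
    then show ?thesis using F0_deg[OF l] unfolding a_def by linarith
  qed
  have f_le: "f l + e l \<le> r" for l
  proof -
    have "f l \<le> card {i \<in> {1..r}. E i l}"
      unfolding f_card using F(2) by (intro card_mono) auto
    then show ?thesis using card_E[of l] by simp
  qed
  have "(\<Sum>l\<in>{1..k}. f l) = (\<Sum>i\<in>{1..r}. \<Sum>l\<in>{1..k}. of_bool (l \<in> F i))"
    unfolding f_def by (rule sum.swap)
  also have "\<dots> = (\<Sum>i\<in>{1..r}. n - r)"
  proof (rule sum.cong[OF refl])
    fix i assume i: "i \<in> {1..r}"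
    have "F i \<subseteq> {1..k}" using F(2)[OF i] by blast
    then show "(\<Sum>l\<in>{1..k}. of_bool (l \<in> F i)) = n - r"
      unfolding F(3)[OF i, symmetric] by (rule sum_of_bool_mem[OF finite_atLeastAtMost])
  qed
  finally have sum_f: "(\<Sum>l\<in>{1..k}. f l) = r * (n - r)" by simp

  \<comment> \<open>\<open>b l\<close> is the extra diagonal entry forced by parity,
    \<open>u l\<close> the number of pairs of occurrences in the corner that may go either on or off
    the diagonal.\<close>
  define b :: "nat \<Rightarrow> nat" where "b l = of_bool (odd (\<rho> l + e l + d l))" for l
  define u where "u l = (\<rho> l - e l - 2 * f l - d l) div 2" for l
  have corner: "\<rho> l = e l + 2 * f l + (d l + b l + 2 * u l)" if l: "l \<in> {1..k}" for l
  proof -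
    have "e l + 2 * f l + d l \<le> \<rho> l" using f_le[of l] room[OF l] unfolding e_def by linarith
    then obtain x where x: "\<rho> l = e l + 2 * f l + d l + x" using le_Suc_ex by blast
    have "odd (\<rho> l + e l + d l) \<longleftrightarrow> odd x" using x by auto
    moreover have "u l = x div 2" using x by (simp add: u_def)
    ultimately show ?thesis
      using x by (cases "odd x") (simp_all add: b_def odd_two_times_div_two_succ)
  qed
  have sum_b: "n = r + (\<Sum>l\<in>{1..k}. d l) + (\<Sum>l\<in>{1..k}. b l) + 2 * t"
    using t unfolding b_def e_def by (simp only: card_eq_sum_of_bool finite_atLeastAtMost)
  have "n\<^sup>2 = (\<Sum>l\<in>{1..k}. e l + 2 * f l + (d l + b l + 2 * u l))"
    unfolding sum_\<rho>[symmetric] by (rule sum.cong[OF refl corner])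
  also have "\<dots> = r\<^sup>2 + 2 * (r * (n - r)) +
      ((\<Sum>l\<in>{1..k}. d l) + (\<Sum>l\<in>{1..k}. b l) + 2 * (\<Sum>l\<in>{1..k}. u l))"
    using sum_occurrences[OF lat] sum_f
    by (simp only: sum.distrib sum_distrib_left[symmetric] e_def)
  \<comment> \<open>Counting cells: the sum of \<open>u\<close> is \<open>t\<close> plus the number
    of cells above the diagonal of the corner.\<close>
  finally have total: "(n - r) * (n - r) = n - r - 2 * t + 2 * (\<Sum>l\<in>{1..k}. u l)"
  proof -
    assume *: "n\<^sup>2 = r\<^sup>2 + 2 * (r * (n - r)) +
      ((\<Sum>l\<in>{1..k}. d l) + (\<Sum>l\<in>{1..k}. b l) + 2 * (\<Sum>l\<in>{1..k}. u l))"
    define m where "m = n - r"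
    have n: "n = r + m" using rn by (simp add: m_def)
    have "m * m = (\<Sum>l\<in>{1..k}. d l) + (\<Sum>l\<in>{1..k}. b l) + 2 * (\<Sum>l\<in>{1..k}. u l)"
      using * unfolding m_def[symmetric] by (simp add: n power2_eq_square algebra_simps)
    moreover have "m - 2 * t = (\<Sum>l\<in>{1..k}. d l) + (\<Sum>l\<in>{1..k}. b l)"
      using sum_b by (simp add: m_def)
    ultimately show ?thesis unfolding m_def[symmetric] by simp
  qed
  have t_le: "2 * t \<le> n - r" using sum_b by linarith
  have "n - r \<le> (n - r) * (n - r)" using rn by simp
  then have "t \<le> (\<Sum>l\<in>{1..k}. u l)" using total t_le by linarith
  \<comment> \<open>Just \<open>t\<close> of these pairs are moved to the diagonal, filling its
    \<open>2 * t\<close> free cells.\<close>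
  then obtain s where s: "\<And>l. l \<in> {1..k} \<Longrightarrow> s l \<le> u l" "(\<Sum>l\<in>{1..k}. s l) = t"
    using exists_bounded_summands[OF finite_atLeastAtMost] by metis
  define h where "h l = d l + b l + 2 * s l" for l
  define p where "p l = u l - s l" for l
  have hp: "\<rho> l = e l + 2 * f l + h l + 2 * p l" if l: "l \<in> {1..k}" for l
    using corner[OF l] s(1)[OF l] by (simp add: h_def p_def)
  have sum_p: "(\<Sum>l\<in>{1..k}. p l) + t = (\<Sum>l\<in>{1..k}. u l)"
    unfolding s(2)[symmetric] sum.distrib[symmetric]
    by (intro sum.cong refl) (use s(1) in \<open>simp add: p_def\<close>)
  have "outline n k \<rho> r L F h p"
    unfolding outline_def f_def[symmetric] e_def[symmetric]
  proof (intro conjI ballI)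
    show "F i \<subseteq> {1..k}" "card (F i) = n - r" "F i \<inter> L i ` {1..r} = {}" if "i \<in> {1..r}" for i
      using F(2,3)[OF that] by (auto simp: E_def)
    show "(\<Sum>l\<in>{1..k}. h l) = n - r"
      using sum_b s(2) unfolding h_def sum.distrib sum_distrib_left[symmetric] by simp
    have "(\<Sum>l\<in>{1..k}. 2 * p l) = (n - r) * (n - r) - (n - r)"
      using sum_p total t_le unfolding sum_distrib_left[symmetric] by linarith
    then show "(\<Sum>l\<in>{1..k}. 2 * p l) = (n - r) * (n - r - 1)"
      by (simp only: diff_mult_distrib2 mult_1_right)
    \<comment> \<open>The left side is \<open>\<rho> l - e l - f l\<close>, so this is the lower
      bound on \<open>f l\<close> obtained from Hall's theorem.\<close>
    show "f l + h l + 2 * p l \<le> n - r" if l: "l \<in> {1..k}" for l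
      using hp[OF l] f_ge[OF l] rn by linarith
    show "e l + 2 * f l + h l + 2 * p l = \<rho> l" if l: "l \<in> {1..k}" for l
      using hp[OF l] by simp
  qed (rule lat sym)+
  from outline_completion[OF this less_imp_le[OF rn] nk] obtain L' where
    L': "rho_latin_square n k \<rho> L'" "symmetric_array n L'" "top_left_subarray r L L'"
      "\<forall>l\<in>{1..k}. card {i \<in> {r+1..n}. L' i i = l} = h l"
    by blast
  moreover have "has_diagonal_tail r n k d L'"
    using L'(4) by (simp only: has_diagonal_tail_def h_def) simp
  ultimately show ?thesis unfolding symmetrically_embeddable_def by blast
qed

section \<open>The equivalence\<close>

lemma half_diff_in_Nats_iff:
  "(real n - real r - real D - real q) / 2 \<in> \<nat> \<longleftrightarrow> (\<exists>t. n = r + D + q + 2 * t)"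
proof
  assume "(real n - real r - real D - real q) / 2 \<in> \<nat>"
  then obtain t where "(real n - real r - real D - real q) / 2 = real t" by (auto elim: Nats_cases)
  then have "real n = real (r + D + q + 2 * t)" by simp
  then show "\<exists>t. n = r + D + q + 2 * t" by (metis of_nat_eq_iff)
qed auto

theorem corollary4p2:
  fixes n k r D q :: nat and \<rho> d e :: "nat \<Rightarrow> nat" and L :: array and A B :: bool
  assumes "0 < n" and "0 < k" and "r < n"
    and "\<forall>l\<in>{1..k}. 1 \<le> \<rho> l \<and> \<rho> l \<le> n" and "n \<le> k"
    and "(\<Sum>l\<in>{1..k}. \<rho> l) = n\<^sup>2"
    and "D = (\<Sum>l\<in>{1..k}. d l)" and "D \<le> n - r"
    and "rho_latin_rectangle r k \<rho> L" and "symmetric_array r L"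
    and "\<forall>l\<in>{1..k}. e l = occurrences r L l"
    and "q = card {l \<in> {1..k}. odd (\<rho> l + e l + d l)}"
    and "\<forall>l\<in>{1..k}. int (e l) \<ge> 2 * int r + int (d l) - int (\<rho> l)"
    and "A \<longleftrightarrow> (\<forall>K\<subseteq>{1..k}.
           (\<Sum>l\<in>K. max 0 (int (\<rho> l) - int (e l) + int r - int n))
             \<le> (\<Sum>i\<in>{1..r}. min (int n - int r) (int (mu_symbols r L K i))))"
    and "B \<longleftrightarrow> (\<forall>I\<subseteq>{1..r}.
           (int n - int r) * (int r - int (card I))
             \<ge> (\<Sum>l\<in>{1..k}. max 0 (int (\<rho> l) - int (e l) - int n + int r - int (mu_rows r L I l))))"
  shows "(symmetrically_embeddable r n k \<rho> d L \<longleftrightarrow>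
            (real n - real r - real D - real q) / 2 \<in> \<nat> \<and> A) \<and>
         (symmetrically_embeddable r n k \<rho> d L \<longleftrightarrow>
            (real n - real r - real D - real q) / 2 \<in> \<nat> \<and> B)"
proof -
  note e = assms(11)[rule_format]
  have lat: "filled_latin r k L" using assms(9) by (simp add: rho_latin_rectangle_def)
  have q: "q = card {l \<in> {1..k}. odd (\<rho> l + occurrences r L l + d l)}"
    unfolding assms(12) using e by (metis (mono_tags, lifting))
  define x where "x l = int (\<rho> l) - int (occurrences r L l) - int n + int r" for l
  have A: "A \<longleftrightarrow> (\<forall>K\<subseteq>{1..k}. (\<Sum>l\<in>K. max 0 (x l))
      \<le> (\<Sum>i\<in>{1..r}. min (int n - int r) (int (mu_symbols r L K i))))"
  proof -
    have "(\<Sum>l\<in>K. max 0 (int (\<rho> l) - int (e l) + int r - int n)) = (\<Sum>l\<in>K. max 0 (x l))"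
      if K: "K \<subseteq> {1..k}" for K
    proof (rule sum.cong[OF refl])
      fix l assume "l \<in> K"
      then have "e l = occurrences r L l" using K e by blast
      then show "max 0 (int (\<rho> l) - int (e l) + int r - int n) = max 0 (x l)" by (simp add: x_def)
    qed
    then show ?thesis unfolding assms(14) by (simp cong: imp_cong)
  qed
  have B: "B \<longleftrightarrow> (\<forall>I\<subseteq>{1..r}. (int n - int r) * (int r - int (card I))
      \<ge> (\<Sum>l\<in>{1..k}. max 0 (x l - int (mu_rows r L I l))))"
  proof -
    have "(\<Sum>l\<in>{1..k}. max 0 (int (\<rho> l) - int (e l) - int n + int r - int (mu_rows r L I l))) =
        (\<Sum>l\<in>{1..k}. max 0 (x l - int (mu_rows r L I l)))" for I
      by (rule sum.cong[OF refl]) (simp only: e x_def)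
    then show ?thesis unfolding assms(15) by simp
  qed
  have "finite {1..k}" by simp
  note C = min_condition_iff[OF this, where a = x and r = r and c = "int n - int r" and L = L]
    max_condition_iff[OF this, where a = x and r = r and c = "int n - int r" and L = L]
  \<comment> \<open>\<open>C\<close> rewrites both conditions to one family indexed by
    \<open>K\<close> and \<open>I\<close>. Necessity yields it in the form \<open>B\<close>,
    sufficiency uses the family itself.\<close>
  have AB: "A \<longleftrightarrow> B" unfolding A B C ..
  have "(\<exists>t. n = r + D + q + 2 * t) \<and> B" if "symmetrically_embeddable r n k \<rho> d L"
    using embeddable_imp_conditions[OF assms(3) lat assms(10) that]
    unfolding B x_def assms(7) q by (rule conjI)
  moreover have "symmetrically_embeddable r n k \<rho> d L" if "\<exists>t. n = r + D + q + 2 * t" and A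
  proof -
    have C1: "\<forall>K\<subseteq>{1..k}. \<forall>I\<subseteq>{1..r}. (\<Sum>l\<in>K. max 0 (x l))
        \<le> (int n - int r) * (int r - int (card I)) + (\<Sum>l\<in>K. int (mu_rows r L I l))"
      using \<open>A\<close> unfolding A C .
    obtain t where t: "n = r + D + q + 2 * t" using \<open>\<exists>t. n = r + D + q + 2 * t\<close> by blast
    show ?thesis
    proof (rule conditions_imp_embeddable)
      show "\<rho> l \<le> n" if "l \<in> {1..k}" for l using assms(4) that by blast
      show "2 * r + d l \<le> \<rho> l + occurrences r L l" if "l \<in> {1..k}" for l
        using assms(13)[rule_format, OF that] e[OF that] by linarith
      show "n = r + (\<Sum>l\<in>{1..k}. d l) + card {l \<in> {1..k}. odd (\<rho> l + occurrences r L l + d l)} + 2 * t"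
        using t unfolding assms(7) q .
      show "(\<Sum>l\<in>K. max 0 (int (\<rho> l) - int (occurrences r L l) - int n + int r))
          \<le> (int n - int r) * (int r - int (card I)) + (\<Sum>l\<in>K. int (mu_rows r L I l))"
        if "K \<subseteq> {1..k}" "I \<subseteq> {1..r}" for K I
        using C1[rule_format, OF that] unfolding x_def .
    qed (rule assms lat)+
  qed
  ultimately show ?thesis unfolding half_diff_in_Nats_iff using AB by blast
qed

end
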